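(* Let $a_1,\dots,a_n$ be positive integers with $\gcd(a_1,\dots,a_n)=1$, let $m=a_1+\dots+a_n$, $P=(a_1/m,\dots,a_n/m)$ and $k=\lceil\log m\rceil$. For every integer $K\ge 2k$, the entropy toll of $\mathrm{ALDR}[P,K]$ is less than two; that is, $$H(P)\le \mathbb{E}[C(\mathrm{ALDR}[P,K])]<H(P)+2.$$
   Context: All logarithms are base 2; $H_1(x)=x\log(1/x)$ (with $H_1(0)=0$), $H(P)=\sum_i H_1(p_i)$. For real $x\ge0$ and integer $d$, $\epsilon_d(x)=\lfloor 2^d x\rfloor \bmod 2$ and $\nu(x)=\sum_d d\,\epsilon_d(x)2^{-d}$. A DDG tree is a sampler driven by i.i.d. fair bits: a full binary tree (possibly with back edges to the root) with labeled leaves; starting at the root one fair bit per step selects the child until a leaf is reached, whose label is output (back edges return to the root). $C(T)$ is the number of bits consumed; the toll is $\tau(T)=\mathbb{E}[C(T)]-H(P_T)$ where $P_T$ is the output distribution. An entropy-optimal DDG tree for $Q=(q_0,\dots,q_n)$ has exactly $\epsilon_d(q_i)$ leaves labeled $i$ at depth $d$, $d\ge1$. FLDR: for positive integers $A_1,\dots,A_n$ with sum $M$, $K'=\lceil\log M\rceil$, $A_0=2^{K'}-M$, $Q=(A_0/2^{K'},A_1/2^{K'},\dots,A_n/2^{K'})$; $\mathrm{FLDR}[A_1,\dots,A_n]$ is an entropy-optimal tree for $Q$ with each leaf labeled $0$ replaced by a back edge to the root; its output distribution is $(A_i/M)_{i=1}^n$ and its expected cost is $(2^{K'}/M)\sum_{i=0}^n\nu(A_i/2^{K'})$.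 ALDR: with $c_K=\lfloor 2^K/m\rfloor$, $\mathrm{ALDR}[P,K]=\mathrm{FLDR}[c_Ka_1,\dots,c_Ka_n]$. *)

theory Defs
  imports "HOL-Probability.Probability"
begin

definition H1 :: "real \<Rightarrow> real" where
  "H1 x = x * log 2 (1 / x)"

definition shannon_entropy :: "'i set \<Rightarrow> ('i \<Rightarrow> real) \<Rightarrow> real" where
  "shannon_entropy I p = (\<Sum>i\<in>I. H1 (p i))"

definition binary_digit :: "int \<Rightarrow> real \<Rightarrow> int" where
  "binary_digit d x = \<lfloor>2 powi d * x\<rfloor> mod 2"

datatype (labels: 'a) ddg = Leaf 'a | Back | Node "'a ddg" "'a ddg"

primrec back_free :: "'a ddg \<Rightarrow> bool" where
  "back_free (Leaf j) \<longleftrightarrow> True"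
| "back_free Back \<longleftrightarrow> False"
| "back_free (Node l r) \<longleftrightarrow> back_free l \<and> back_free r"

primrec num_leaves :: "'a ddg \<Rightarrow> 'a \<Rightarrow> nat \<Rightarrow> nat" where
  "num_leaves (Leaf j) i d = (if j = i \<and> d = 0 then 1 else 0)"
| "num_leaves Back i d = 0"
| "num_leaves (Node l r) i d =
     (case d of 0 \<Rightarrow> 0 | Suc e \<Rightarrow> num_leaves l i e + num_leaves r i e)"

text \<open>Traversing a back edge means being at the root at once: it consumes no extra bit.
  Leaves are absorbing.\<close>

fun ddg_step :: "'a ddg \<Rightarrow> 'a ddg \<Rightarrow> bool \<Rightarrow> 'a ddg" where
  "ddg_step rt (Node l r) b = (case (if b then r else l) of Back \<Rightarrow> rt | s \<Rightarrow> s)"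
| "ddg_step rt s b = s"

primrec ddg_walk :: "'a ddg \<Rightarrow> bool stream \<Rightarrow> nat \<Rightarrow> 'a ddg" where
  "ddg_walk T \<omega> 0 = T"
| "ddg_walk T \<omega> (Suc t) = ddg_step T (ddg_walk T \<omega> t) (\<omega> !! t)"

definition fair_bits :: "bool stream measure" where
  "fair_bits = stream_space (measure_pmf (bernoulli_pmf (1/2)))"

definition ddg_cost :: "'a ddg \<Rightarrow> bool stream \<Rightarrow> enat" where
  "ddg_cost T \<omega> =
     (if \<exists>t i. ddg_walk T \<omega> t = Leaf i
      then enat (LEAST t. \<exists>i. ddg_walk T \<omega> t = Leaf i) else \<infinity>)"

definition ddg_expected_cost :: "'a ddg \<Rightarrow> ereal" where
  "ddg_expected_cost T = enn2ereal (\<integral>\<^sup>+\<omega>. ennreal_of_enat (ddg_cost T \<omega>) \<partial>fair_bits)"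

definition ddg_output_prob :: "'a ddg \<Rightarrow> 'a \<Rightarrow> real" where
  "ddg_output_prob T i =
     measure fair_bits {\<omega> \<in> space fair_bits. \<exists>t. ddg_walk T \<omega> t = Leaf i}"

definition ddg_toll :: "'a ddg \<Rightarrow> ereal" where
  "ddg_toll T =
     ddg_expected_cost T - ereal (shannon_entropy (labels T) (ddg_output_prob T))"

text \<open>Depth \<open>0\<close> is included so that a point mass, whose only nonzero digit is the one with
  index \<open>0\<close>, is sampled by the correctly labelled single leaf.  If all probabilities are
  below one, the digits with index \<open>0\<close> vanish and only depths \<open>d \<ge> 1\<close> matter.\<close>

definition entropy_optimal_ddg :: "nat \<Rightarrow> (nat \<Rightarrow> real) \<Rightarrow> nat ddg \<Rightarrow> bool" where
  "entropy_optimal_ddg n q T \<longleftrightarrow>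
     back_free T \<and> labels T \<subseteq> {0..n} \<and>
     (\<forall>i\<in>{0..n}. \<forall>d. int (num_leaves T i d) = binary_digit (int d) (q i))"

primrec zero_to_back :: "nat ddg \<Rightarrow> nat ddg" where
  "zero_to_back (Leaf j) = (if j = 0 then Back else Leaf j)"
| "zero_to_back Back = Back"
| "zero_to_back (Node l r) = Node (zero_to_back l) (zero_to_back r)"

definition fldr_depth :: "nat \<Rightarrow> (nat \<Rightarrow> nat) \<Rightarrow> nat" where
  "fldr_depth n A = nat \<lceil>log 2 (real (\<Sum>i=1..n. A i))\<rceil>"

definition fldr_proposal :: "nat \<Rightarrow> (nat \<Rightarrow> nat) \<Rightarrow> nat \<Rightarrow> real" where
  "fldr_proposal n A i =
     (if i = 0 then 2 ^ fldr_depth n A - real (\<Sum>i=1..n. A i) else real (A i))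
       / 2 ^ fldr_depth n A"

text \<open>An entropy-optimal tree is determined only up to the arrangement of its leaves within
  each level, so FLDR and ALDR are predicates on trees.\<close>

definition is_FLDR :: "nat \<Rightarrow> (nat \<Rightarrow> nat) \<Rightarrow> nat ddg \<Rightarrow> bool" where
  "is_FLDR n A T \<longleftrightarrow>
     (\<exists>S. entropy_optimal_ddg n (fldr_proposal n A) S \<and> T = zero_to_back S)"

definition is_ALDR :: "nat \<Rightarrow> (nat \<Rightarrow> nat) \<Rightarrow> nat \<Rightarrow> nat ddg \<Rightarrow> bool" where
  "is_ALDR n a K T \<longleftrightarrow> is_FLDR n (\<lambda>i. (2 ^ K div (\<Sum>i=1..n. a i)) * a i) T"

text \<open>Trees satisfying the predicates above exist, so statements about all of them are not vacuous.\<close>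

lemma pair_up_forest:
  fixes Ts :: "'a ddg list"
  assumes "length Ts = 2 * N" "\<forall>T\<in>set Ts. back_free T"
  shows "\<exists>Us. length Us = N \<and> (\<forall>U\<in>set Us. back_free U) \<and>
    (\<forall>i d. (\<Sum>U\<leftarrow>Us. num_leaves U i d) =
       (case d of 0 \<Rightarrow> 0 | Suc e \<Rightarrow> \<Sum>T\<leftarrow>Ts. num_leaves T i e))"
  using assms
proof (induction N arbitrary: Ts)
  case 0
  then show ?case by (auto split: nat.split)
next
  case (Suc N)
  then obtain x y zs where Ts: "Ts = x # y # zs"
    by (metis length_Suc_conv mult_Suc_right numeral_2_eq_2 add_Suc)
  with Suc.prems Suc.IH[of zs] obtain Us where "length Us = N" "\<forall>U\<in>set Us. back_free U"
    "\<forall>i d. (\<Sum>U\<leftarrow>Us. num_leaves U i d) =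
       (case d of 0 \<Rightarrow> 0 | Suc e \<Rightarrow> \<Sum>T\<leftarrow>zs. num_leaves T i e)" by auto
  with Ts Suc.prems show ?case
    by (intro exI[of _ "Node x y # Us"]) (auto split: nat.split)
qed

lemma kraft_forest:
  fixes L :: "nat \<Rightarrow> 'a list"
  assumes "(\<Sum>d\<le>D. length (L d) * 2 ^ (D - d)) = N * 2 ^ D"
  shows "\<exists>Ts. length Ts = N \<and> (\<forall>T\<in>set Ts. back_free T) \<and>
    (\<forall>i d. (\<Sum>T\<leftarrow>Ts. num_leaves T i d) = (if d \<le> D then count_list (L d) i else 0))"
  using assms
proof (induction D arbitrary: L N)
  case 0
  have "(\<Sum>T\<leftarrow>map Leaf xs. num_leaves T i d) = (if d = 0 then count_list xs i else 0)"
    for xs :: "'a list" and i d by (induction xs) auto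
  with 0 show ?case by (intro exI[of _ "map Leaf (L 0)"]) (auto simp del: map_map)
next
  case (Suc D)
  have eq: "length (L 0) * 2 ^ Suc D + (\<Sum>d\<le>D. length (L (Suc d)) * 2 ^ (D - d)) = N * 2 ^ Suc D"
    using Suc.prems by (subst (asm) sum.atMost_Suc_shift) simp
  hence le: "length (L 0) \<le> N"
    by (metis le_add1 mult_le_cancel2 zero_less_numeral zero_less_power)
  have "(\<Sum>d\<le>D. length (L (Suc d)) * 2 ^ (D - d)) = 2 * (N - length (L 0)) * 2 ^ D"
    using eq le by (simp add: algebra_simps diff_mult_distrib)
  from Suc.IH[of "\<lambda>d. L (Suc d)", OF this] obtain Ts where Ts:
    "length Ts = 2 * (N - length (L 0))" "\<forall>T\<in>set Ts. back_free T"
    "\<And>i d. (\<Sum>T\<leftarrow>Ts. num_leaves T i d) = (if d \<le> D then count_list (L (Suc d)) i else 0)"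
    by blast
  from pair_up_forest[OF Ts(1,2)] obtain Us where Us:
    "length Us = N - length (L 0)" "\<forall>U\<in>set Us. back_free U"
    "\<And>i d. (\<Sum>U\<leftarrow>Us. num_leaves U i d) =
       (case d of 0 \<Rightarrow> 0 | Suc e \<Rightarrow> \<Sum>T\<leftarrow>Ts. num_leaves T i e)" by blast
  have lf: "(\<Sum>T\<leftarrow>map Leaf xs. num_leaves T i d) = (if d = 0 then count_list xs i else 0)"
    for xs :: "'a list" and i d by (induction xs) auto
  show ?case
    using Us le lf
    by (intro exI[of _ "map Leaf (L 0) @ Us"]) (auto simp: Ts(3) simp del: map_map split: nat.split)
qed

lemma binary_digit_dyadic:
  "binary_digit (int d) (real B / 2 ^ D) =
     (if d \<le> D then int (B div 2 ^ (D - d) mod 2) else 0)"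
proof (cases "d \<le> D")
  case True
  have "2 powi int d * (real B / 2 ^ D) = real B / real (2 ^ (D - d))"
    using True power_add[of "2 :: real" d "D - d"] by (simp add: field_simps)
  then show ?thesis using True
    by (simp only: binary_digit_def floor_divide_of_nat_eq) (simp add: zmod_int)
next
  case False
  then have "2 powi int d * (real B / 2 ^ D) = of_int (int B * 2 ^ (d - D))"
    using power_add[of "2 :: real" D "d - D"] by (simp add: field_simps)
  then have "\<lfloor>2 powi int d * (real B / 2 ^ D)\<rfloor> = int B * 2 ^ (d - D)"
    by (simp only: floor_of_int)
  moreover have "even (2 ^ (d - D) :: int)" using False by simp
  ultimately show ?thesis using False by (simp add: binary_digit_def)
qed

lemma binary_expansion:
  "B < 2 ^ Suc D \<Longrightarrow> (\<Sum>d\<le>D. (B div 2 ^ (D - d) mod 2) * 2 ^ (D - d)) = (B :: nat)"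
proof (induction D arbitrary: B)
  case (Suc D)
  have "(\<Sum>d\<le>D. (B div 2 ^ (Suc D - d) mod 2) * 2 ^ (Suc D - d)) =
    2 * (\<Sum>d\<le>D. ((B div 2) div 2 ^ (D - d) mod 2) * 2 ^ (D - d))"
    unfolding sum_distrib_left
    by (intro sum.cong) (auto simp: Suc_diff_le div_mult2_eq)
  also have "\<dots> = 2 * (B div 2)" using Suc by simp
  finally show ?case by simp
qed simp

lemma num_leaves_pos: "i \<in> labels T \<Longrightarrow> \<exists>d. num_leaves T i d > 0"
proof (induction T)
  case (Node l r)
  then obtain d where "num_leaves l i d + num_leaves r i d > 0" by auto
  then show ?case by (intro exI[of _ "Suc d"]) simp
qed auto

lemma entropy_optimal_ddg_exists:
  fixes B :: "nat \<Rightarrow> nat"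
  assumes sum: "(\<Sum>i\<le>n. B i) = 2 ^ D"
  shows "\<exists>T. entropy_optimal_ddg n (\<lambda>i. real (B i) / 2 ^ D) T"
proof -
  define L where "L d = filter (\<lambda>i. B i div 2 ^ (D - d) mod 2 = 1) [0..<Suc n]" for d
  have B: "B i < 2 ^ Suc D" if "i \<le> n" for i
    using member_le_sum[of i "{..n}" B] that sum
    by (simp add: le_less_trans[of _ "2 ^ D"])
  have len: "length (L d) = (\<Sum>i\<le>n. B i div 2 ^ (D - d) mod 2)" for d
  proof -
    have "length (L d) = card {i \<in> {..n}. B i div 2 ^ (D - d) mod 2 = 1}"
      unfolding L_def
      by (subst distinct_card[symmetric])
        (auto intro!: arg_cong[where f = card] simp del: upt_Suc)
    also have "\<dots> = (\<Sum>i\<le>n. if B i div 2 ^ (D - d) mod 2 = 1 then 1 else 0)"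
      by (simp add: sum.If_cases Int_def)
    also have "\<dots> = (\<Sum>i\<le>n. B i div 2 ^ (D - d) mod 2)"
      by (intro sum.cong) (auto simp: mod2_eq_if)
    finally show ?thesis .
  qed
  have "(\<Sum>d\<le>D. length (L d) * 2 ^ (D - d)) =
    (\<Sum>i\<le>n. \<Sum>d\<le>D. (B i div 2 ^ (D - d) mod 2) * 2 ^ (D - d))"
    unfolding len sum_distrib_right by (rule sum.swap)
  also have "\<dots> = 1 * 2 ^ D"
    using sum B by (simp add: binary_expansion del: power_Suc)
  finally obtain Ts where Ts: "length Ts = 1" "\<forall>T\<in>set Ts. back_free T"
    "\<forall>i d. (\<Sum>T\<leftarrow>Ts. num_leaves T i d) = (if d \<le> D then count_list (L d) i else 0)"
    using kraft_forest[of L D 1] by blast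
  then obtain T where T: "back_free T"
    "\<And>i d. num_leaves T i d = (if d \<le> D then count_list (L d) i else 0)"
    by (auto simp: length_Suc_conv)
  have cnt: "count_list (L d) i =
    (if i \<le> n then B i div 2 ^ (D - d) mod 2 else 0)" for d i
  proof -
    have "distinct (L d)" by (simp add: L_def)
    then have "count_list (L d) i = (if i \<in> set (L d) then 1 else 0)"
      by (auto simp: distinct_count_atmost_1 count_list_0_iff
          simp flip: count_mset)
    then show ?thesis by (auto simp: L_def mod2_eq_if)
  qed
  have "labels T \<subseteq> {0..n}"
  proof
    fix i assume "i \<in> labels T"
    then obtain d where "num_leaves T i d > 0" using num_leaves_pos by metis
    then show "i \<in> {0..n}" by (auto simp: T(2) cnt split: if_splits)
  qed
  with T(1) have "entropy_optimal_ddg n (\<lambda>i. real (B i) / 2 ^ D) T"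
    by (auto simp: entropy_optimal_ddg_def binary_digit_dyadic T(2) cnt)
  then show ?thesis ..
qed

lemma is_FLDR_exists:
  assumes "0 < (\<Sum>i=1..n. A i)"
  shows "\<exists>T. is_FLDR n A T"
proof -
  define M where "M = (\<Sum>i=1..n. A i)"
  define D where "D = fldr_depth n A"
  have "log 2 (real M) \<le> real D"
    unfolding D_def fldr_depth_def M_def by linarith
  then have "real M \<le> 2 powr real D"
    using assms by (subst log_le_iff[symmetric]) (simp_all add: M_def del: of_nat_sum)
  then have "real M \<le> real (2 ^ D)" by (simp add: powr_realpow)
  then have M: "M \<le> 2 ^ D" by (simp only: of_nat_le_iff)
  define B where "B i = (if i = 0 then 2 ^ D - M else A i)" for i
  have "(\<Sum>i\<le>n. B i) = B 0 + (\<Sum>i=1..n. B i)"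
    by (simp add: atMost_atLeast0 sum.atLeast_Suc_atMost)
  also have "(\<Sum>i=1..n. B i) = M" unfolding M_def by (intro sum.cong) (auto simp: B_def)
  finally have "(\<Sum>i\<le>n. B i) = 2 ^ D" using M by (simp add: B_def)
  moreover have "fldr_proposal n A = (\<lambda>i. real (B i) / 2 ^ D)"
    using M by (auto simp: fun_eq_iff fldr_proposal_def B_def D_def[symmetric]
        M_def of_nat_diff)
  ultimately show ?thesis
    using entropy_optimal_ddg_exists[of B n D] by (auto simp: is_FLDR_def)
qed

lemma is_ALDR_exists:
  assumes "0 < (\<Sum>i=1..n. a i)" "(\<Sum>i=1..n. a i) \<le> 2 ^ K"
  shows "\<exists>T. is_ALDR n a K T"
  unfolding is_ALDR_def
  by (rule is_FLDR_exists) (use assms in \<open>simp add: div_greater_zero_iff flip: sum_distrib_left\<close>)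

end

theory Submission
  imports Defs
begin

text \<open>
  Write \<open>A\<^sub>0 = 2\<^sup>K mod m\<close>, \<open>c = 2\<^sup>K div m\<close>, \<open>q = A\<^sub>0 / 2\<^sup>K\<close> and \<open>s(x) = 2 x + H1 x - \<nu>(x)\<close>. The toll is below two iff
  the slacks \<open>s(c a\<^sub>i / 2\<^sup>K)\<close> add up to more than \<open>N = \<nu>(q) + H1 (1 - q)\<close>. Since \<open>s(2 x) = 2 s(x)\<close>, each item
  may be scaled by the power \<open>2\<^sup>j\<close> for which \<open>m/2 < v \<le> m\<close>, where \<open>v = 2\<^sup>j a\<^sub>i\<close>. If \<open>v = m\<close>, complementing
  the digits of \<open>q\<close> gives a slack above \<open>N - 2 q\<close>. If \<open>v < m\<close>, the slack exceeds
  \<open>(v/m) (N - 2 q) + (1 - v/m) 2\<^sup>k q\<close>. Summing up, the total is more than \<open>N - 2 q + 2\<^sup>k q U\<close>, where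
  \<open>U = (\<Sum>\<^sub>i 2\<^sup>-\<^sup>j) - 1\<close> is a multiple of \<open>2\<^sup>1\<^sup>-\<^sup>k\<close>, and it is positive because the \<open>a\<^sub>i\<close> have no common
  divisor. Hence \<open>2\<^sup>k q U \<ge> 2 q\<close>.
\<close>

section \<open>Binary entropy\<close>

text \<open>The slack of \<open>c * v\<close> depends on binary digits and is erratic in
  \<open>v\<close>. Two smooth minorants replace it: the entropy of the complementary fraction,
  which is good for \<open>v\<close> near \<open>m\<close> but degenerates to 0 as
  \<open>c * v / 2 ^ K\<close> approaches 1/2, and a tangent line, which takes over for smaller
  \<open>v\<close>.

  The rate \<open>2 ^ k * q\<close> demanded of items with \<open>v < m\<close> is dictated by the
  sum: U can be as small as \<open>2 / 2 ^ k\<close> and still has to repay the loss 2 q suffered at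
  \<open>v = m\<close>. The hypothesis \<open>2 * k \<le> K\<close> keeps this rate below 1, because
  the remainder is below \<open>2 ^ k\<close>. The rate can be large only for
  \<open>K = 2 * k\<close>; for small \<open>k\<close> this leaves few denominators, whose
  remainders are listed.

  The link to trees is a renewal equation: a back edge costs the unknown expectation again. It can
  be solved only once the expectation is known to be finite.\<close>

definition bent :: "real \<Rightarrow> real" where
  "bent x = H1 x + H1 (1 - x)"

lemma H1_eq: "H1 x = - (x * log 2 x)"
  by (cases "x = 0") (simp_all add: H1_def log_divide)

text \<open>The inequality ln y <= y - 1 at y = \<open>z / x\<close>. The correction
  \<open>(z - x) / ln 2\<close> is kept because it cancels when summed over values \<open>x\<close>
  and \<open>z\<close> with equal totals.\<close>

lemma H1_le_cross:
  assumes "0 \<le> x" "0 < z"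
  shows "H1 x \<le> - (x * log 2 z) + (z - x) / ln 2"
proof (cases "x = 0")
  case True
  then show ?thesis using assms by (simp add: H1_def)
next
  case False
  with assms have x: "0 < x" by simp
  have "ln (z / x) \<le> z / x - 1"
    using assms x by (intro ln_le_minus_one) simp
  then have "x * ln (z / x) \<le> x * (z / x - 1)"
    using x by (intro mult_left_mono) auto
  then have "x * (ln z - ln x) \<le> z - x"
    using x assms by (simp add: ln_div algebra_simps)
  then have "x * (ln z - ln x) / ln 2 \<le> (z - x) / ln 2"
    by (intro divide_right_mono) auto
  then show ?thesis
    by (simp add: H1_eq log_def field_simps)
qed

text \<open>The right-hand side is the tangent of \<open>bent\<close> at \<open>z\<close>. Concavity
  and the tangent estimates below rest on it.\<close>

lemma bent_le_cross:
  assumes "0 \<le> x" "x \<le> 1" "0 < z" "z < 1"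
  shows "bent x \<le> - (x * log 2 z) - (1 - x) * log 2 (1 - z)"
  using H1_le_cross[of x z] H1_le_cross[of "1 - x" "1 - z"] assms
  by (simp add: bent_def diff_divide_distrib)

lemma bent_eq: "bent x = - (x * log 2 x) - (1 - x) * log 2 (1 - x)"
  by (simp add: bent_def H1_eq)

lemma bent_chord:
  assumes "0 \<le> x" "x \<le> 1" "0 \<le> y" "y \<le> 1" "0 \<le> a" "a \<le> 1"
    and z: "z = (1 - a) * x + a * y" "0 < z" "z < 1"
  shows "(1 - a) * bent x + a * bent y \<le> bent z"
proof -
  have "(1 - a) * bent x + a * bent y
    \<le> (1 - a) * (- (x * log 2 z) - (1 - x) * log 2 (1 - z))
      + a * (- (y * log 2 z) - (1 - y) * log 2 (1 - z))"
    using assms by (intro add_mono mult_left_mono bent_le_cross) auto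
  also have "\<dots> = - (((1 - a) * x + a * y) * log 2 z) - (1 - ((1 - a) * x + a * y)) * log 2 (1 - z)"
    by (simp add: algebra_simps)
  also have "\<dots> = bent z"
    by (simp add: bent_eq z(1))
  finally show ?thesis .
qed

text \<open>The grouping property of entropy for the outcomes \<open>u\<close>, \<open>(1-u)q\<close>, \<open>(1-u)(1-q)\<close>, with the
  entropy of the pair \<open>u\<close>, \<open>(1-u)q\<close> replaced by a cross entropy against \<open>l\<close>, \<open>1-l\<close>.\<close>

lemma bent_mix_ge:
  assumes "0 < u" "u < 1" "0 < q" "q < 1" "0 < l" "l < 1"
  shows "bent u + u * log 2 l + (1 - u) * q * log 2 (1 - l)
    \<le> bent (u + (1 - u) * q) - (1 - u) * bent q"
proof -
  define r where "r = (1 - u) * q"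
  define t where "t = u + r"
  have r: "0 < r" using assms by (simp add: r_def)
  have t: "0 < t" using r assms by (simp add: t_def)
  have t1: "1 - t = (1 - u) * (1 - q)" by (simp add: t_def r_def algebra_simps)
  have lt1: "log 2 (1 - t) = log 2 (1 - u) + log 2 (1 - q)"
    using assms by (simp add: t1 log_mult)
  have lr: "log 2 r = log 2 (1 - u) + log 2 q"
    using assms by (simp add: r_def log_mult)
  \<comment> \<open>The references \<open>t * l\<close> and \<open>t * (1 - l)\<close> add up to
    \<open>t = u + r\<close>, so the corrections cancel. Equality holds for
    \<open>l = u / t\<close>; a constant \<open>l\<close> avoids logarithms depending on
    \<open>q\<close>.\<close>
  have "H1 u \<le> - (u * log 2 (t * l)) + (t * l - u) / ln 2"
    using assms t by (intro H1_le_cross) auto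
  moreover have "H1 r \<le> - (r * log 2 (t * (1 - l))) + (t * (1 - l) - r) / ln 2"
    using assms t r by (intro H1_le_cross) auto
  moreover have "(t * l - u) / ln 2 + (t * (1 - l) - r) / ln 2 = 0"
    by (simp add: t_def flip: add_divide_distrib) (simp add: algebra_simps)
  ultimately have main: "H1 u + H1 r
    \<le> - (u * log 2 (t * l)) - r * log 2 (t * (1 - l))" by linarith
  have "bent t - (1 - u) * bent q - (bent u + u * log 2 l + r * log 2 (1 - l))
      = - (u * log 2 (t * l)) - r * log 2 (t * (1 - l)) - H1 u - H1 r"
    using assms t
    by (simp add: bent_eq H1_eq lt1 lr log_mult t1) (simp add: t_def r_def algebra_simps)
  with main show ?thesis by (simp add: t_def r_def)
qed

section \<open>Weights of binary digits\<close>

text \<open>\<open>bit_weight A\<close> is the sum of \<open>j 2\<^sup>j\<close> over the positions \<open>j\<close> of the binary digits \<open>1\<close> of \<open>A\<close>,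
  so that \<open>\<nu>(A / 2\<^sup>K) = (K A - bit_weight A) / 2\<^sup>K\<close>.\<close>

fun bit_weight :: "nat \<Rightarrow> nat" where
  "bit_weight A = (if A = 0 then 0 else 2 * bit_weight (A div 2) + 2 * (A div 2))"

declare bit_weight.simps [simp del]

lemma bit_weight_0 [simp]: "bit_weight 0 = 0"
  by (simp add: bit_weight.simps)

text \<open>Halving moves a digit from position j to j - 1, and \<open>j * 2 ^ j\<close> is twice
  \<open>(j - 1) * 2 ^ (j - 1)\<close> plus twice \<open>2 ^ (j - 1)\<close>.\<close>

lemma bit_weight_rec: "bit_weight A = 2 * bit_weight (A div 2) + 2 * (A div 2)"
  by (subst bit_weight.simps) auto

lemma bit_weight_double: "bit_weight (2 * A) = 2 * bit_weight A + 2 * A"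
  using bit_weight_rec[of "2 * A"] by simp

lemma bit_weight_double_Suc: "bit_weight (Suc (2 * A)) = 2 * bit_weight A + 2 * A"
  using bit_weight_rec[of "Suc (2 * A)"] by simp

lemma bit_weight_digits:
  "A < 2 ^ Suc K \<Longrightarrow> (\<Sum>j\<le>K. (A div 2 ^ j mod 2) * 2 ^ j * j) = bit_weight A"
proof (induction K arbitrary: A)
  case 0
  then have "A = 0 \<or> A = 1" by auto
  then show ?case using bit_weight_rec[of 1] by auto
next
  case (Suc K)
  have A: "A div 2 < 2 ^ Suc K" using Suc.prems by simp
  have e: "A div 2 div 2 ^ j = A div 2 ^ Suc j" for j
    by (simp add: div_mult2_eq)
  have "(\<Sum>j\<le>Suc K. (A div 2 ^ j mod 2) * 2 ^ j * j)
    = (\<Sum>j\<le>K. (A div 2 div 2 ^ j mod 2) * 2 ^ Suc j * Suc j)"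
    by (subst sum.atMost_Suc_shift) (simp add: e del: power_Suc)
  also have "\<dots> = 2 * (\<Sum>j\<le>K. (A div 2 div 2 ^ j mod 2) * 2 ^ j * j)
      + 2 * (\<Sum>j\<le>K. (A div 2 div 2 ^ j mod 2) * 2 ^ j)"
    by (simp add: sum_distrib_left algebra_simps flip: sum.distrib)
  also have "(\<Sum>j\<le>K. (A div 2 div 2 ^ j mod 2) * 2 ^ j) = A div 2"
    using binary_expansion[OF A] sum.nat_diff_reindex[of "\<lambda>j. (A div 2 div 2 ^ j mod 2) * 2 ^ j" "Suc K"]
    by (simp add: lessThan_Suc_atMost)
  finally show ?case using Suc.IH[OF A] bit_weight_rec[of A] by simp
qed

text \<open>Serves to compare \<open>A\<close> with \<open>A - 1\<close>, the digitwise complement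
  of \<open>2 ^ K - A\<close>.\<close>

lemma bit_weight_mono_Suc: "bit_weight A \<le> bit_weight (Suc A)"
proof (induction A rule: less_induct)
  case (less A)
  show ?case
  proof (cases "even A")
    case True
    then obtain a where "A = 2 * a" by blast
    then show ?thesis by (simp add: bit_weight_double bit_weight_double_Suc)
  next
    case False
    then obtain a where a: "A = Suc (2 * a)" by (auto elim: oddE)
    with less[of a] bit_weight_double[of "Suc a"] show ?thesis
      by (simp add: bit_weight_double_Suc)
  qed
qed

text \<open>The digits of the two numbers share out the positions below \<open>L\<close>, and the
  right-hand side is the sum of \<open>j * 2 ^ j\<close> over these positions.\<close>

lemma bit_weight_complement:
  "A < 2 ^ L \<Longrightarrow>
    real (bit_weight A) + real (bit_weight (2 ^ L - 1 - A)) = (real L - 2) * 2 ^ L + 2"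
proof (induction L arbitrary: A)
  case (Suc L)
  define a where "a = A div 2"
  have a: "a < 2 ^ L" using Suc.prems by (simp add: a_def)
  have d: "(2 ^ Suc L - 1 - A) div 2 = 2 ^ L - 1 - a"
    using Suc.prems a unfolding a_def by simp
  have "real (bit_weight A) + real (bit_weight (2 ^ Suc L - 1 - A))
    = 2 * (real (bit_weight a) + real (bit_weight (2 ^ L - 1 - a))) + 2 * (real a + real (2 ^ L - 1 - a))"
    using bit_weight_rec[of A] bit_weight_rec[of "2 ^ Suc L - 1 - A"]
    unfolding d a_def[symmetric] by simp
  also have "real a + real (2 ^ L - 1 - a) = 2 ^ L - 1"
    using a by (simp add: of_nat_diff flip: of_nat_add)
  finally show ?case using Suc.IH[OF a] by (simp add: algebra_simps)
qed simp

lemma xlogx_mono: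
  fixes x y :: real
  assumes "1 \<le> x" "x \<le> y"
  shows "x * log 2 x \<le> y * log 2 y"
  using assms by (intro mult_mono) auto

text \<open>Every digit sits at a position of at most \<open>log 2 A\<close>, and the digit values
  add up to \<open>A\<close>. In terms of x = \<open>A / 2 ^ K\<close> this says that
  \<open>H1\<close> x is at most \<nu>(x), which gives the lower bound on the cost.\<close>

lemma bit_weight_le: "real (bit_weight A) \<le> real A * log 2 (real A)"
proof (induction A rule: less_induct)
  case (less A)
  show ?case
  proof (cases "A \<le> 1")
    case True
    then have "A = 0 \<or> A = 1" by auto
    then show ?thesis using bit_weight_rec[of 1] by auto
  next
    case False
    define a where "a = A div 2"
    have a: "a < A" "1 \<le> a" "2 * a \<le> A" using False by (auto simp: a_def)
    have "real (bit_weight A) = 2 * real (bit_weight a) + 2 * real a"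
      by (subst bit_weight_rec) (simp add: a_def)
    also have "\<dots> \<le> 2 * (real a * log 2 (real a)) + 2 * real a"
      using less a by simp
    also have "\<dots> = real (2 * a) * log 2 (real (2 * a))"
      using a by (simp add: log_mult algebra_simps)
    also have "\<dots> \<le> real A * log 2 (real A)"
      using a by (intro xlogx_mono) auto
    finally show ?thesis .
  qed
qed

text \<open>\<open>slack A\<close> is \<open>2\<^sup>K (H1 x + 2 x - \<nu>(x))\<close> for \<open>x = A / 2\<^sup>K\<close>; it does not depend on \<open>K\<close>.\<close>

definition slack :: "nat \<Rightarrow> real" where
  "slack A = 2 * real A - real A * log 2 (real A) + real (bit_weight A)"

lemma slack_double: "slack (2 * A) = 2 * slack A"
  by (cases "A = 0") (simp_all add: slack_def bit_weight_double log_mult distrib_left)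

lemma slack_power: "slack (2 ^ j * A) = 2 ^ j * slack A"
  by (induction j) (simp_all add: slack_double mult.assoc)

lemma log2_power: "log 2 (2 ^ K) = real K"
  by (simp add: log_nat_power)

text \<open>The weight of \<open>A\<close> is bounded below through its complementary digits, whose weight is at most
  the entropic one.\<close>

lemma slack_gt_bent:
  assumes "0 < A" "A < 2 ^ L"
  shows "2 ^ L * (bent (1 - real A / 2 ^ L) - 2 * (1 - real A / 2 ^ L)) < slack A"
proof -
  define C where "C = 2 ^ L - 1 - A"
  define Y where "Y = 2 ^ L - real A"
  have Y: "Y = real C + 1" using assms by (simp add: C_def Y_def of_nat_diff)
  have "real C * log 2 (real C) \<le> Y * log 2 Y"
    by (cases "C = 0") (auto simp: Y intro!: xlogx_mono)
  then have C: "real (bit_weight C) \<le> Y * log 2 Y"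
    using bit_weight_le[of C] by linarith
  have B: "real (bit_weight A) = (real L - 2) * 2 ^ L + 2 - real (bit_weight C)"
    using bit_weight_complement[OF assms(2)] by (simp add: C_def)
  have Ypos: "0 < Y" using Y by simp
  have A: "0 < real A" using assms by simp
  have e: "1 - real A / 2 ^ L = Y / 2 ^ L" by (simp add: Y_def diff_divide_distrib)
  have e': "1 - Y / 2 ^ L = real A / 2 ^ L" by (simp add: Y_def diff_divide_distrib)
  have "2 ^ L * bent (1 - real A / 2 ^ L)
    = - (Y * (log 2 Y - real L)) - real A * (log 2 (real A) - real L)"
    using A Ypos unfolding e by (simp add: bent_eq e' log_divide log2_power right_diff_distrib)
  also have "\<dots> = real L * 2 ^ L - Y * log 2 Y - real A * log 2 (real A)"
    by (simp add: Y_def algebra_simps)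
  finally have h: "2 ^ L * bent (1 - real A / 2 ^ L)
    = real L * 2 ^ L - Y * log 2 Y - real A * log 2 (real A)" .
  have "2 ^ L * (bent (1 - real A / 2 ^ L) - 2 * (1 - real A / 2 ^ L))
    = real L * 2 ^ L - Y * log 2 Y - real A * log 2 (real A) - 2 * Y"
    unfolding right_diff_distrib h by (simp add: Y_def)
  \<comment> \<open>Strict because of the summand 2 from
    \<open>bit_weight_complement\<close>.\<close>
  also have "\<dots> < slack A"
    using C by (simp add: slack_def B Y_def algebra_simps)
  finally show ?thesis .
qed

lemma bent_0 [simp]: "bent 0 = 0" by (simp add: bent_def H1_def)
lemma bent_half: "bent (1 / 2) = 1"
  by (simp add: bent_eq log_divide)

lemma bent_ge_double:
  assumes "0 \<le> t" "t \<le> 1 / 2"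
  shows "2 * t \<le> bent t"
proof (cases "t = 0")
  case False
  then show ?thesis
    using bent_chord[of 0 "1/2" "2 * t" t] assms by (simp add: bent_half)
qed simp

lemma ex_power2_bracket:
  assumes "0 < (A::nat)"
  shows "\<exists>L. 2 ^ L \<le> A \<and> A < 2 ^ Suc L"
  using ex_power_ivl1[of 2 A] assms by auto

text \<open>The single-outcome bound \<nu>(x) < \<open>H1\<close> x + 2 x. If \<open>L\<close> is
  the position of the leading digit, the complementary fraction is at most 1/2, where
  \<open>bent\<close> lies above its chord.\<close>

lemma slack_pos:
  assumes "0 < A"
  shows "0 < slack A"
proof -
  obtain L where L: "2 ^ L \<le> A" "A < 2 ^ Suc L" using ex_power2_bracket[OF assms] by blast
  have "real (2 ^ L) \<le> real A" "real A < real (2 ^ Suc L)"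
    using L by (simp_all only: of_nat_le_iff of_nat_less_iff)
  then have t: "0 \<le> 1 - real A / 2 ^ Suc L" "1 - real A / 2 ^ Suc L \<le> 1 / 2"
    by (simp_all add: field_simps)
  have "0 \<le> 2 ^ Suc L * (bent (1 - real A / 2 ^ Suc L) - 2 * (1 - real A / 2 ^ Suc L))"
    using bent_ge_double[OF t] by (intro mult_nonneg_nonneg) auto
  also have "\<dots> < slack A" by (rule slack_gt_bent[OF assms L(2)])
  finally show ?thesis .
qed

text \<open>The line is the tangent at \<open>3/4\<close>, where the digits below the leading \<open>1/2\<close> can be most
  expensive.\<close>

lemma slack_ge_line:
  assumes "2 ^ K \<le> A" "A < 2 ^ Suc K"
  shows "2 ^ Suc K * (3 / 2 - real A / 2 ^ Suc K * log 2 3) \<le> slack A"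
proof (cases "A = 2 ^ K")
  case True
  have "slack (2 ^ K) = 2 ^ K * slack 1" using slack_power[of K 1] by simp
  also have "slack 1 = 2" using bit_weight_rec[of 1] by (simp add: slack_def)
  finally have "slack A = 2 ^ K * 2" using True by simp
  moreover have "(1::real) \<le> log 2 3" by simp
  ultimately show ?thesis
    using True by (simp add: field_simps)
next
  case False
  define Z where "Z = A - 2 ^ K"
  have Z: "A = 2 ^ K + Z" "0 < Z" "Z < 2 ^ K" using assms False by (auto simp: Z_def)
  have bw: "bit_weight (2 ^ K + Z) = K * 2 ^ K + bit_weight Z" if "Z < 2 ^ K" for K Z
    using that
  proof (induction K arbitrary: Z)
    case 0
    then show ?case using bit_weight_rec[of 1] by simp
  next
    case (Suc K)
    have z: "Z div 2 < 2 ^ K" using Suc.prems by simp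
    have d: "(2 ^ Suc K + Z) div 2 = 2 ^ K + Z div 2" by simp
    show ?case
      using Suc.IH[OF z] bit_weight_rec[of Z] bit_weight_rec[of "2 ^ Suc K + Z"]
      unfolding d by (simp add: algebra_simps)
  qed
  have "slack Z > 0" using Z by (intro slack_pos) auto
  then have sz: "real Z * log 2 (real Z) - 2 * real Z < real (bit_weight Z)" by (simp add: slack_def)
  define x where "x = real Z / real A"
  have A: "0 < real A" "0 < real Z" using Z by (auto intro: add_pos_pos)
  have x: "0 \<le> x" "x \<le> 1" using A Z by (auto simp: x_def)
  have x1: "1 - x = 2 ^ K / real A" using A Z by (simp add: x_def field_simps)
  \<comment> \<open>When \<open>A / 2 ^ Suc K\<close> is 3/4, the digits below the leading one make
    up one third of \<open>A\<close>; hence the reference value 1/3.\<close>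
  have "real A * bent x \<le> real A * (- (x * log 2 (1 / 3)) - (1 - x) * log 2 (1 - 1 / 3))"
    using x A by (intro mult_left_mono bent_le_cross) auto
  moreover have "log 2 (1 / 3) = - log 2 (3::real)" "log 2 (1 - 1 / 3) = 1 - log 2 (3::real)"
    by (simp_all add: log_divide)
  moreover have "real A * x = real Z" "real A * (1 - x) = 2 ^ K" using A by (simp_all add: x1) (simp add: x_def)
  ultimately have "real A * bent x \<le> real Z * log 2 3 - 2 ^ K * (1 - log 2 3)"
    by (simp add: right_diff_distrib flip: mult.assoc)
  moreover have "real A * bent x = - real Z * log 2 x - 2 ^ K * log 2 (1 - x)"
    using \<open>real A * x = real Z\<close> \<open>real A * (1 - x) = 2 ^ K\<close>
    by (simp add: bent_eq right_diff_distrib flip: mult.assoc)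
  moreover have "log 2 x = log 2 (real Z) - log 2 (real A)"
    "log 2 (1 - x) = real K - log 2 (real A)"
    using A by (simp_all add: x_def log_divide) (simp add: x1 log_divide log2_power flip: x_def)
  ultimately have "- real Z * (log 2 (real Z) - log 2 (real A)) - 2 ^ K * (real K - log 2 (real A))
     \<le> real Z * log 2 3 - 2 ^ K * (1 - log 2 3)" by simp
  then have "real A * log 2 (real A) \<le> real A * log 2 3 - 2 ^ K + 2 ^ K * real K + real Z * log 2 (real Z)"
    using Z(1) by (simp add: algebra_simps)
  moreover have "2 ^ Suc K * (3 / 2 - real A / 2 ^ Suc K * log 2 3) = 3 * 2 ^ K - real A * log 2 3"
    by (simp add: right_diff_distrib)
  moreover have "real (bit_weight A) = real K * 2 ^ K + real (bit_weight Z)"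
    using bw[OF Z(3)] Z(1) by simp
  moreover have "real A = 2 ^ K + real Z" using Z(1) by simp
  ultimately show ?thesis
    using sz by (simp add: slack_def mult.commute[of "2 ^ K" "real K"])
qed

section \<open>Numerical estimates\<close>

lemma log2_le:
  assumes "0 < x" "0 < q" "x ^ q \<le> 2 ^ p"
  shows "log 2 x \<le> real p / real q"
proof -
  have "log 2 (x ^ q) \<le> log 2 (2 ^ p)"
    using assms by (subst log_le_cancel_iff) auto
  then have "real q * log 2 x \<le> real p"
    using assms by (simp add: log_nat_power)
  then show ?thesis using assms by (simp add: field_simps)
qed

lemma log2_ge:
  assumes "0 < x" "0 < q" "2 ^ p \<le> x ^ q"
  shows "real p / real q \<le> log 2 x"
proof -
  have "log 2 (2 ^ p) \<le> log 2 (x ^ q)"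
    using assms by (subst log_le_cancel_iff) auto
  then have "real p \<le> real q * log 2 x"
    using assms by (simp add: log_nat_power)
  then show ?thesis using assms by (simp add: field_simps)
qed

text \<open>The fractions for 3, 5 and 7 are continued fraction convergents, so each bound compares
  two integer powers, such as \<open>2 ^ 84\<close> and \<open>3 ^ 53\<close>.\<close>

lemma log2_bounds:
  "84 / 53 \<le> log 2 (3::real)" "log 2 (3::real) \<le> 65 / 41" "log 2 (5::real) \<le> 7 / 3"
  "14 / 5 \<le> log 2 (7::real)" "log 2 (7::real) \<le> 73 / 26"
  "- (1 / 21) \<le> log 2 (31 / 32 :: real)" "- (1 / 80) \<le> log 2 (127 / 128 :: real)"
proof -
  show "84 / 53 \<le> log 2 (3::real)" using log2_ge[of 3 53 84] by simp
  show "log 2 (3::real) \<le> 65 / 41" using log2_le[of 3 41 65] by simp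
  show "log 2 (5::real) \<le> 7 / 3" using log2_le[of 5 3 7] by simp
  show "14 / 5 \<le> log 2 (7::real)" using log2_ge[of 7 5 14] by simp
  show "log 2 (7::real) \<le> 73 / 26" using log2_le[of 7 26 73] by simp
  show "- (1 / 21) \<le> log 2 (31 / 32 :: real)"
    using log2_le[of "32 / 31" 21 1] by (simp add: power_divide log_divide)
  show "- (1 / 80) \<le> log 2 (127 / 128 :: real)"
    using log2_le[of "128 / 127" 80 1] by (simp add: power_divide log_divide)
qed

lemma log2_pow [simp]:
  "log 2 4 = (2::real)" "log 2 8 = (3::real)" "log 2 16 = (4::real)" "log 2 32 = (5::real)" "log 2 128 = (7::real)"
  using log2_power[of 2] log2_power[of 3] log2_power[of 4] log2_power[of 5] log2_power[of 7] by simp_all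

text \<open>7/5 is a round value below 1 / ln 2.\<close>

lemma log2_one_minus_le:
  assumes "0 \<le> u" "u < 1"
  shows "log 2 (1 - u) \<le> - (7 / 5 * u)"
proof -
  have "ln (1 - u) \<le> - u" using assms ln_le_minus_one[of "1 - u"] by simp
  moreover have "7 / 5 * u * ln 2 \<le> 7 / 5 * u * (25 / 36)"
    using assms ln2_le_25_over_36 by (intro mult_left_mono) auto
  ultimately have "ln (1 - u) \<le> - (7 / 5 * u) * ln 2" using assms by simp
  then show ?thesis by (simp add: log_def field_simps)
qed

text \<open>The point \<open>2 powr - real k\<close> bounds \<open>1 - v / m\<close> from below, so
  it is the left end of the range of \<open>u\<close>.\<close>

lemma bent_power_ge: "2 powr - real k * (real k + (1 - 2 powr - real k) * (7 / 5)) \<le> bent (2 powr - real k)"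
proof (cases "k = 0")
  case False
  define u where "u = 2 powr - real k"
  have u: "0 < u" "u < 1" using False by (simp_all add: u_def powr_less_one)
  have "log 2 u = - real k" by (simp add: u_def)
  moreover have "(1 - u) * log 2 (1 - u) \<le> (1 - u) * (- (7 / 5 * u))"
    using u by (intro mult_left_mono log2_one_minus_le) auto
  ultimately show ?thesis by (simp add: bent_eq algebra_simps flip: u_def)
qed (simp add: bent_eq)

text \<open>With \<open>u = 1 - v/m\<close>, \<open>q = A\<^sub>0 / 2\<^sup>K\<close> and \<open>\<theta> = 2\<^sup>k q\<close>, the slack of \<open>c v\<close> is large enough as soon
  as one of the following two functions is nonnegative: they compare the required amount
  with the entropy bound and with the tangent bound. \<open>psi\<close> is concave and \<open>lin\<close> is affine in
  \<open>u\<close>, so only a few values have to be checked numerically.\<close>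

definition psi :: "real \<Rightarrow> real \<Rightarrow> real \<Rightarrow> real" where
  "psi q \<theta> u = bent (u + (1 - u) * q) - 2 * (u + (1 - u) * q) - (1 - u) * bent q - u * \<theta>"

definition lin :: "real \<Rightarrow> real \<Rightarrow> real \<Rightarrow> real" where
  "lin q \<theta> u = 3 / 2 - (1 - u) * (1 - q) * log 2 3 - (1 - u) * bent q - u * \<theta>"

section \<open>Nonnegativity of \<open>psi\<close> and \<open>lin\<close>\<close>

lemma psi_interval:
  assumes "0 < q" "q < 1" "0 < u1" "u1 \<le> u" "u \<le> u2" "u2 < 1"
    and "0 \<le> psi q \<theta> u1" "0 \<le> psi q \<theta> u2"
  shows "0 \<le> psi q \<theta> u"
proof (cases "u1 = u2")
  case True
  then show ?thesis using assms by simp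
next
  case False
  define a where "a = (u - u1) / (u2 - u1)"
  have a: "0 \<le> a" "a \<le> 1" using assms False by (auto simp: a_def field_simps)
  have u: "u = (1 - a) * u1 + a * u2"
  proof -
    have "a * (u2 - u1) = u - u1" using False by (simp add: a_def)
    then show ?thesis by (simp add: algebra_simps)
  qed
  define t where "t v = v + (1 - v) * q" for v
  have tb: "0 < t v" "t v < 1" if "0 < v" "v < 1" for v
  proof -
    show "0 < t v" using that assms by (simp add: t_def add_pos_pos)
    have "0 < (1 - v) * (1 - q)" using that assms by simp
    then show "t v < 1" by (simp add: t_def algebra_simps)
  qed
  have "t u = (1 - a) * t u1 + a * t u2" by (simp add: t_def u algebra_simps)
  then have "(1 - a) * bent (t u1) + a * bent (t u2) \<le> bent (t u)"
    using assms a tb[of u] tb[of u1] tb[of u2] by (intro bent_chord) auto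
  then have "(1 - a) * psi q \<theta> u1 + a * psi q \<theta> u2 \<le> psi q \<theta> u"
    unfolding psi_def t_def[symmetric] by (simp add: t_def u algebra_simps)
  moreover have "0 \<le> (1 - a) * psi q \<theta> u1 + a * psi q \<theta> u2"
    using a assms by simp
  ultimately show ?thesis by simp
qed

text \<open>\<open>bent_mix_ge\<close> separates \<open>u\<close> from \<open>q\<close>. What
  remains is monotone in \<open>q\<close> and \<open>\<theta>\<close>, so upper bounds for them
  suffice, and \<open>bent\<close> is needed only at the chosen \<open>u\<close>. At each use
  \<open>l\<close> is a round value near \<open>u / (u + (1 - u) * q)\<close>.\<close>

lemma psi_nonneg:
  assumes "0 < u" "u < 1" "0 < q" "q < 1" "0 < l" "l < 1"
    and q: "q \<le> q'" and \<theta>: "\<theta> \<le> \<theta>'"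
    and le: "(2 + \<theta>' - log 2 l) * u + (2 - log 2 (1 - l)) * ((1 - u) * q') \<le> bent u"
  shows "0 \<le> psi q \<theta> u"
proof -
  have "log 2 (1 - l) \<le> 0" using assms by simp
  then have "0 \<le> 2 - log 2 (1 - l)" by simp
  then have "(2 - log 2 (1 - l)) * ((1 - u) * q) \<le> (2 - log 2 (1 - l)) * ((1 - u) * q')"
    using assms by (intro mult_left_mono) auto
  moreover have "(2 + \<theta> - log 2 l) * u \<le> (2 + \<theta>' - log 2 l) * u"
    using assms by (intro mult_right_mono) auto
  moreover have "psi q \<theta> u = bent (u + (1 - u) * q) - (1 - u) * bent q
      - (bent u + u * log 2 l + (1 - u) * q * log 2 (1 - l))
      + bent u - (2 + \<theta> - log 2 l) * u - (2 - log 2 (1 - l)) * ((1 - u) * q)"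
    by (simp add: psi_def algebra_simps)
  ultimately show ?thesis
    using le bent_mix_ge[of u q l] assms by linarith
qed

text \<open>An affine function of \<open>u\<close> is controlled by its values at \<open>u1\<close>
  and at 1, where only \<theta>' <= 3/2 matters. \<open>bent q\<close> is replaced by its tangent at
  \<open>z\<close>; the sign condition on \<open>z\<close> makes the resulting bound increase with
  \<open>q\<close>, so \<open>q'\<close> may stand for \<open>q\<close>.\<close>

lemma lin_nonneg:
  assumes "u1 \<le> u" "u < 1" "0 < q" "q < 1" "0 < z" "z < 1"
    and q: "q \<le> q'" and \<theta>: "\<theta> \<le> \<theta>'" and "\<theta>' \<le> 3 / 2" "0 \<le> u1"
    and z: "log 2 3 - log 2 (1 - z) + log 2 z \<le> 0"
    and le: "(1 - u1) * (log 2 3 - log 2 (1 - z) - q' * (log 2 3 - log 2 (1 - z) + log 2 z)) + u1 * \<theta>' \<le> 3 / 2"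
  shows "0 \<le> lin q \<theta> u"
proof -
  define g where "g = log 2 3 - log 2 (1 - z) + log 2 z"
  define d where "d = log 2 3 - log 2 (1 - z) - q' * g"
  have "(1 - q) * log 2 3 + bent q \<le> log 2 3 - log 2 (1 - z) - q * g"
    using bent_le_cross[of q z] assms by (simp add: g_def algebra_simps)
  also have "\<dots> \<le> d"
    using mult_right_mono_neg[OF q, of g] z by (simp add: d_def g_def)
  finally have "(1 - u) * ((1 - q) * log 2 3 + bent q) \<le> (1 - u) * d"
    using assms by (intro mult_left_mono) auto
  moreover have "u * \<theta> \<le> u * \<theta>'" using assms by (intro mult_left_mono) auto
  moreover have "(1 - u) * d + u * \<theta>' \<le> 3 / 2"
  proof (cases "\<theta>' \<le> d")
    case True
    have "(1 - u) * d + u * \<theta>' = d - u * (d - \<theta>')" by (simp add: algebra_simps)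
    also have "\<dots> \<le> d - u1 * (d - \<theta>')" using True assms by (simp add: mult_right_mono)
    also have "\<dots> = (1 - u1) * d + u1 * \<theta>'" by (simp add: algebra_simps)
    also have "\<dots> \<le> 3 / 2" using le by (simp add: d_def g_def)
    finally show ?thesis .
  next
    case False
    have "(1 - u) * d + u * \<theta>' \<le> (1 - u) * \<theta>' + u * \<theta>'"
      using False assms by (intro add_mono mult_left_mono) auto
    also have "\<dots> = \<theta>'" by (simp add: algebra_simps)
    finally show ?thesis using assms by simp
  qed
  ultimately show ?thesis by (simp add: lin_def algebra_simps)
qed

text \<open>Here \<open>q = \<theta> * u\<close>, so a factor \<open>u\<close> cancels and a
  condition without \<open>q\<close> is left.\<close>

lemma psi_nonneg_at_power:
  assumes "0 < q" "q < 1" "0 < l" "l < 1" "2 \<le> k" "\<theta> = 2 ^ k * q" "\<theta> \<le> \<theta>'"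
    and le: "2 + \<theta>' - log 2 l + (2 - log 2 (1 - l)) * \<theta>' \<le> real k + (1 - 2 powr - real k) * (7 / 5)"
  shows "0 \<le> psi q \<theta> (2 powr - real k)"
proof -
  define u where "u = 2 powr - real k"
  have "u \<le> 2 powr - 2" unfolding u_def using assms by (intro powr_mono) auto
  then have u: "0 < u" "u < 1" by (simp_all add: u_def powr_minus)
  have pk: "2 ^ k * u = 1" by (simp add: u_def powr_minus powr_realpow)
  have q: "q = \<theta> * u" using assms(6) pk by (simp add: algebra_simps)
  have l: "log 2 (1 - l) \<le> 0" using assms by simp
  have "0 < \<theta>" using assms by simp
  have "(2 - log 2 (1 - l)) * ((1 - u) * q) \<le> (2 - log 2 (1 - l)) * (\<theta>' * u)"
  proof (rule mult_left_mono)
    have "(1 - u) * q \<le> 1 * q" using u assms by (intro mult_right_mono) auto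
    also have "\<dots> \<le> \<theta>' * u" using u assms(7) by (simp add: q)
    finally show "(1 - u) * q \<le> \<theta>' * u" .
  qed (use l in auto)
  then have "(2 + \<theta>' - log 2 l) * u + (2 - log 2 (1 - l)) * ((1 - u) * q)
    \<le> u * (2 + \<theta>' - log 2 l + (2 - log 2 (1 - l)) * \<theta>')"
    by (simp add: algebra_simps)
  also have "\<dots> \<le> u * (real k + (1 - u) * (7 / 5))"
    using le u by (intro mult_left_mono) (auto simp: u_def)
  also have "\<dots> \<le> bent u" unfolding u_def by (rule bent_power_ge)
  finally have "0 \<le> psi q \<theta> u"
    using assms u by (intro psi_nonneg[where l = l and q' = q and \<theta>' = \<theta>']) auto
  then show ?thesis by (simp add: u_def)
qed

lemma bent_values:
  "bent (1 / 4) = 2 - 3 / 4 * log 2 3"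
  "bent (2 / 9) = 2 * log 2 3 - 2 / 9 - 7 / 9 * log 2 7"
  "bent (1 / 6) = 1 + log 2 3 - 5 / 6 * log 2 5"
  "bent (1 / 8) = 3 - 7 / 8 * log 2 7"
proof -
  have "log 2 9 = 2 * log 2 (3::real)" using log_nat_power[of 3 2 2] by simp
  moreover have "log 2 6 = 1 + log 2 (3::real)" using log_mult[of 2 3 2] by simp
  ultimately show "bent (1 / 4) = 2 - 3 / 4 * log 2 3"
    "bent (2 / 9) = 2 * log 2 3 - 2 / 9 - 7 / 9 * log 2 7"
    "bent (1 / 6) = 1 + log 2 3 - 5 / 6 * log 2 5"
    "bent (1 / 8) = 3 - 7 / 8 * log 2 7"
    by (simp_all add: bent_eq log_divide field_simps)
qed

lemma power2_mono_bound:
  fixes q :: real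
  assumes "\<theta> = 2 ^ k * q" "\<theta> \<le> \<theta>'" "k0 \<le> k" "0 < q"
  shows "q \<le> \<theta>' / 2 ^ k0"
proof -
  have "2 ^ k0 * q \<le> 2 ^ k * q" using assms by (intro mult_right_mono power_increasing) auto
  also have "\<dots> \<le> \<theta>'" using assms by simp
  finally show ?thesis by (simp add: field_simps)
qed

text \<open>With \<open>l = 1 / 2\<close> and \<theta>' = 1 the left-hand side of the condition in
  \<open>psi_nonneg_at_power\<close> is exactly 7; this is the threshold for
  \<open>k\<close>.\<close>

lemma psi_or_lin_large:
  assumes "0 < q" "q < 1" "7 \<le> k" "\<theta> = 2 ^ k * q" "\<theta> \<le> 1" "2 powr - real k \<le> u" "u < 1"
  shows "0 \<le> psi q \<theta> u \<or> 0 \<le> lin q \<theta> u"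
proof (cases "u \<le> 1 / 4")
  case True
  have q: "q \<le> 1 / 2 ^ 7" using power2_mono_bound[OF assms(4,5,3,1)] .
  have "2 powr - real k \<le> 1"
    using powr_mono[of "- real k" 0 2] by simp
  then have "7 \<le> real k + (1 - 2 powr - real k) * (7 / 5)"
    using assms(3) by (simp add: add_increasing2)
  then have "0 \<le> psi q \<theta> (2 powr - real k)"
    using assms by (intro psi_nonneg_at_power[where l = "1 / 2" and \<theta>' = 1]) (auto simp: log_divide; simp add: field_simps)+
  moreover have "0 \<le> psi q \<theta> (1 / 4)"
    using assms q log2_bounds
    by (intro psi_nonneg[where l = "31 / 32" and q' = "1 / 2 ^ 7" and \<theta>' = 1])
      (auto simp: log_divide bent_values; simp add: field_simps)+
  ultimately show ?thesis
    using assms True psi_interval[of q "2 powr - real k" u "1 / 4" \<theta>] by auto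
next
  case False
  have q: "q \<le> 1 / 2 ^ 7" using power2_mono_bound[OF assms(4,5,3,1)] .
  have "0 \<le> lin q \<theta> u"
    using assms q log2_bounds False
    by (intro lin_nonneg[where ?u1.0 = "1 / 4" and z = "1 / 128" and q' = "1 / 2 ^ 7" and \<theta>' = 1])
      (auto simp: log_divide; simp add: field_simps)+
  then show ?thesis ..
qed

text \<open>9/16 is the largest \<open>\<theta>\<close> for \<open>k = 4\<close>,
  \<open>K = 8\<close>: it comes from 256 mod 13 = 9.\<close>

lemma psi_or_lin_medium:
  assumes "0 < q" "q < 1" "4 \<le> k" "\<theta> = 2 ^ k * q" "\<theta> \<le> 9 / 16" "2 powr - real k \<le> u" "u < 1"
  shows "0 \<le> psi q \<theta> u \<or> 0 \<le> lin q \<theta> u"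
proof (cases "u \<le> 2 / 9")
  case True
  have q: "q \<le> 9 / 16 / 2 ^ 4" using power2_mono_bound[OF assms(4,5,3,1)] .
  have "2 powr - real k \<le> 2 powr - 4" using assms by (intro powr_mono) auto
  then have "2 powr - real k \<le> 1 / 16" by (simp add: powr_minus)
  then have "0 \<le> psi q \<theta> (2 powr - real k)"
    using assms log2_bounds of_nat_mono[OF assms(3), where 'a = real]
    by (intro psi_nonneg_at_power[where l = "2 / 3" and \<theta>' = "9 / 16"]) (auto simp: log_divide; simp add: field_simps)+
  moreover have "0 \<le> psi q \<theta> (2 / 9)"
    using assms q log2_bounds
    by (intro psi_nonneg[where l = "7 / 8" and q' = "9 / 16 / 2 ^ 4" and \<theta>' = "9 / 16"])
      (auto simp: log_divide bent_values; simp add: field_simps)+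
  ultimately show ?thesis
    using assms True psi_interval[of q "2 powr - real k" u "2 / 9" \<theta>] by auto
next
  case False
  have q: "q \<le> 9 / 16 / 2 ^ 4" using power2_mono_bound[OF assms(4,5,3,1)] .
  have "0 \<le> lin q \<theta> u"
    using assms q log2_bounds False
    by (intro lin_nonneg[where ?u1.0 = "2 / 9" and z = "1 / 32" and q' = "9 / 16 / 2 ^ 4" and \<theta>' = "9 / 16"])
      (auto simp: log_divide; simp add: field_simps)+
  then show ?thesis ..
qed

text \<open>25/32 comes from 1024 mod 27 = 25 for \<open>k = 5\<close>, \<open>K = 10\<close>.
  Between 2/9 and 6/25 neither estimate is available; the fractions that occur avoid this
  gap.\<close>

lemma psi_or_lin_five:
  assumes "0 < q" "q < 1" "5 \<le> k" "\<theta> = 2 ^ k * q" "\<theta> \<le> 25 / 32" "2 powr - real k \<le> u" "u < 1"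
    and u: "u \<le> 2 / 9 \<or> 6 / 25 \<le> u"
  shows "0 \<le> psi q \<theta> u \<or> 0 \<le> lin q \<theta> u"
proof (cases "u \<le> 2 / 9")
  case True
  have q: "q \<le> 25 / 32 / 2 ^ 5" using power2_mono_bound[OF assms(4,5,3,1)] .
  have "2 powr - real k \<le> 2 powr - 5" using assms by (intro powr_mono) auto
  then have "2 powr - real k \<le> 1 / 32" by (simp add: powr_minus)
  then have "0 \<le> psi q \<theta> (2 powr - real k)"
    using assms log2_bounds of_nat_mono[OF assms(3), where 'a = real]
    by (intro psi_nonneg_at_power[where l = "1 / 2" and \<theta>' = "25 / 32"]) (auto simp: log_divide; simp add: field_simps)+
  moreover have "0 \<le> psi q \<theta> (2 / 9)"
    using assms q log2_bounds
    by (intro psi_nonneg[where l = "7 / 8" and q' = "25 / 32 / 2 ^ 5" and \<theta>' = "25 / 32"])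
      (auto simp: log_divide bent_values; simp add: field_simps)+
  ultimately show ?thesis
    using assms True psi_interval[of q "2 powr - real k" u "2 / 9" \<theta>] by auto
next
  case False
  have q: "q \<le> 25 / 32 / 2 ^ 5" using power2_mono_bound[OF assms(4,5,3,1)] .
  have "0 \<le> lin q \<theta> u"
    using assms q log2_bounds False
    by (intro lin_nonneg[where ?u1.0 = "6 / 25" and z = "1 / 32" and q' = "25 / 32 / 2 ^ 5" and \<theta>' = "25 / 32"])
      (auto simp: log_divide; simp add: field_simps)+
  then show ?thesis ..
qed

text \<open>One more digit halves the bound on \<open>q\<close>, and the line already works from 2/9
  on.\<close>

lemma psi_or_lin_six:
  assumes "0 < q" "q < 1" "6 \<le> k" "\<theta> = 2 ^ k * q" "\<theta> \<le> 25 / 32" "2 powr - real k \<le> u" "u < 1"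
  shows "0 \<le> psi q \<theta> u \<or> 0 \<le> lin q \<theta> u"
proof (cases "u \<le> 2 / 9")
  case True
  then show ?thesis using assms by (intro psi_or_lin_five[where k = k]) auto
next
  case False
  have q: "q \<le> 25 / 32 / 2 ^ 6" using power2_mono_bound[OF assms(4,5,3,1)] .
  have "0 \<le> lin q \<theta> u"
    using assms q log2_bounds False
    by (intro lin_nonneg[where ?u1.0 = "2 / 9" and z = "1 / 32" and q' = "25 / 32 / 2 ^ 6" and \<theta>' = "25 / 32"])
      (auto simp: log_divide; simp add: field_simps)+
  then show ?thesis ..
qed

lemma psi_or_lin_three:
  assumes "0 < q" "q \<le> 1 / 32" "\<theta> \<le> 1 / 4" "1 / 8 \<le> u" "u < 1"
  shows "0 \<le> psi q \<theta> u \<or> 0 \<le> lin q \<theta> u"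
proof (cases "u \<le> 1 / 6")
  case True
  have "0 \<le> psi q \<theta> (1 / 8)"
    using assms log2_bounds
    by (intro psi_nonneg[where l = "7 / 8" and q' = "1 / 32" and \<theta>' = "1 / 4"])
      (auto simp: log_divide bent_values; simp add: field_simps)+
  moreover have "0 \<le> psi q \<theta> (1 / 6)"
    using assms log2_bounds
    by (intro psi_nonneg[where l = "7 / 8" and q' = "1 / 32" and \<theta>' = "1 / 4"])
      (auto simp: log_divide bent_values; simp add: field_simps)+
  ultimately show ?thesis
    using assms True psi_interval[of q "1 / 8" u "1 / 6" \<theta>] by auto
next
  case False
  have "0 \<le> lin q \<theta> u"
    using assms log2_bounds False
    by (intro lin_nonneg[where ?u1.0 = "1 / 6" and z = "1 / 32" and q' = "1 / 32" and \<theta>' = "1 / 4"])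
      (auto simp: log_divide; simp add: field_simps)+
  then show ?thesis ..
qed

lemma lin_two:
  assumes "0 < q" "q \<le> 1 / 16" "\<theta> \<le> 1 / 4" "1 / 3 \<le> u" "u < 1"
  shows "0 \<le> lin q \<theta> u"
  using assms log2_bounds
  by (intro lin_nonneg[where ?u1.0 = "1 / 3" and z = "1 / 32" and q' = "1 / 16" and \<theta>' = "1 / 4"])
    (auto simp: log_divide; simp add: field_simps)+

section \<open>The total slack\<close>

text \<open>For \<open>A\<^sub>0 + A\<^sub>1 + \<dots> + A\<^sub>n = 2\<^sup>K\<close> and \<open>M = 2\<^sup>K - A\<^sub>0\<close>, the toll of FLDR is
  \<open>2 + (excess K A\<^sub>0 - \<Sum>\<^sub>i slack A\<^sub>i) / M\<close>, where \<open>i\<close> ranges over \<open>1, \<dots>, n\<close>.\<close>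

definition excess :: "nat \<Rightarrow> nat \<Rightarrow> real" where
  "excess K A = real K * 2 ^ K - real (bit_weight A) - (2 ^ K - real A) * log 2 (2 ^ K - real A)"

lemma excess_0 [simp]: "excess K 0 = 0"
  by (simp add: excess_def log2_power)

text \<open>The two sides differ by \<open>slack A\<close>.\<close>

lemma excess_less_bent:
  assumes "0 < A" "A < 2 ^ K"
  shows "excess K A - 2 * real A < 2 ^ K * bent (real A / 2 ^ K)"
proof -
  have lt: "real A < 2 ^ K" using assms(2) by (metis of_nat_less_iff of_nat_numeral of_nat_power)
  have "1 - real A / 2 ^ K = (2 ^ K - real A) / 2 ^ K" by (simp add: field_simps)
  then have "2 ^ K * bent (real A / 2 ^ K)
      = - real A * (log 2 (real A) - real K) - (2 ^ K - real A) * (log 2 (2 ^ K - real A) - real K)"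
    using assms lt by (simp add: bent_eq log_divide log2_power right_diff_distrib)
  also have "\<dots> = excess K A - 2 * real A + slack A"
    by (simp add: excess_def slack_def algebra_simps)
  finally show ?thesis using slack_pos[OF assms(1)] by simp
qed

text \<open>The contribution of the rejected outcome to the lower bound on the cost.\<close>

lemma excess_nonneg:
  assumes "A < 2 ^ K"
  shows "0 \<le> excess K A"
proof -
  have lt: "real A < 2 ^ K" using assms by (metis of_nat_less_iff of_nat_numeral of_nat_power)
  have "real A * log 2 (real A) \<le> real A * real K"
  proof (cases "A = 0")
    case False
    then have "log 2 (real A) \<le> log 2 (2 ^ K)" using lt by (subst log_le_cancel_iff) auto
    then show ?thesis by (simp add: log2_power mult_left_mono)
  qed simp
  moreover have "(2 ^ K - real A) * log 2 (2 ^ K - real A) \<le> (2 ^ K - real A) * real K"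
  proof (rule mult_left_mono)
    have "log 2 (2 ^ K - real A) \<le> log 2 (2 ^ K)" using lt by (subst log_le_cancel_iff) auto
    then show "log 2 (2 ^ K - real A) \<le> real K" by (simp add: log2_power)
  qed (use lt in simp)
  ultimately show ?thesis
    using bit_weight_le[of A] by (simp add: excess_def algebra_simps)
qed

lemma slack_complement_ge:
  assumes "0 < A" "A < 2 ^ K"
  shows "excess K A - 2 * real A < slack (2 ^ K - A)"
proof -
  \<comment> \<open>Complementing digits subtracts from \<open>2 ^ K - 1\<close>, hence
    \<open>A - 1\<close> and the monotonicity step below.\<close>
  have "2 ^ K - 1 - (2 ^ K - A) = A - 1" using assms by simp
  then have "real (bit_weight (2 ^ K - A)) + real (bit_weight (A - 1)) = (real K - 2) * 2 ^ K + 2"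
    using bit_weight_complement[of "2 ^ K - A" K] assms by simp
  moreover have "real (bit_weight (A - 1)) \<le> real (bit_weight A)"
    using bit_weight_mono_Suc[of "A - 1"] assms by simp
  moreover have "real (2 ^ K - A) = 2 ^ K - real A" using assms by (simp add: of_nat_diff)
  ultimately show ?thesis unfolding slack_def excess_def by (simp add: left_diff_distrib)
qed

section \<open>The slack of a single scaled item, for \<open>m\<close> not a power of two\<close>

locale aldr_denominator =
  fixes m k K c R :: nat
  assumes k: "0 < k" and m_gt: "2 ^ (k - 1) < m" and m_lt: "m < 2 ^ k" and K: "2 * k \<le> K"
    and c_eq: "c = 2 ^ K div m" and R_eq: "R = 2 ^ K mod m" and R_pos: "0 < R"
begin

lemma m_pos: "0 < m" using m_gt by simp

lemma split: "2 ^ K = c * m + R"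
  by (simp add: c_eq R_eq)

lemma R_less_m: "R < m" using m_pos by (simp add: R_eq)

lemma two_k: "(2::nat) ^ k * 2 ^ k \<le> 2 ^ K"
  using K power_increasing[of "2 * k" K "2::nat"] by (simp add: mult_2 power_add)

text \<open>A first use of \<open>2 * k \<le> K\<close>. Since the remainder is below
  \<open>m\<close>, hence below \<open>c\<close>, an integer \<open>v > m / 2\<close> makes
  \<open>c * v\<close> at least half of \<open>2 ^ K\<close>.\<close>

lemma m_le_c: "m \<le> c"
proof -
  have "m * m \<le> 2 ^ k * 2 ^ k" using m_lt by (intro mult_mono) auto
  then have "m * m \<le> 2 ^ K" using two_k by linarith
  then show ?thesis unfolding c_eq using m_pos by (simp add: less_eq_div_iff_mult_less_eq)
qed

lemma R_less: "R < 2 ^ K"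
  using split m_pos m_le_c R_less_m by (metis add_less_cancel_right add_0 mult_pos_pos not_less order.strict_trans2)

definition q :: real where "q = real R / 2 ^ K"
definition \<theta> :: real where "\<theta> = 2 ^ k * q"

lemma q_bounds: "0 < q" "q < 1"
proof -
  show "0 < q" using R_pos by (simp add: q_def)
  have "real R < real (2 ^ K)" using R_less by (simp only: of_nat_less_iff)
  then show "q < 1" by (simp add: q_def)
qed

text \<open>For \<open>u = 1 - v / m\<close> the fraction \<open>c * v / 2 ^ K\<close> equals
  \<open>(1 - u) * (1 - q)\<close>, so \<open>slack_gt_bent\<close> and \<open>slack_ge_line\<close>
  turn into the conditions on \<open>psi\<close> and \<open>lin\<close>.\<close>

lemma item_of_psi_or_lin:
  assumes v: "m < 2 * v" "v < m"
    and good: "0 \<le> psi q \<theta> (1 - real v / real m) \<or> 0 \<le> lin q \<theta> (1 - real v / real m)"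
  shows "real v / real m * (excess K R - 2 * real R) + (1 - real v / real m) * (real R * 2 ^ k)
    < slack (c * v)"
proof -
  define u where "u = 1 - real v / real m"
  define t where "t = u + (1 - u) * q"
  have "real (2 ^ K) = real (c * m + R)" by (simp only: split)
  then have sp: "(2::real) ^ K = real c * real m + real R" by simp
  have "1 - q = (2 ^ K - real R) / 2 ^ K" by (simp add: q_def diff_divide_distrib)
  then have cm: "1 - q = real c * real m / 2 ^ K" using sp by simp
  have "1 - t = (1 - u) * (1 - q)" by (simp add: t_def algebra_simps)
  also have "\<dots> = real (c * v) / 2 ^ K" using m_pos by (simp add: cm u_def)
  finally have t: "1 - t = real (c * v) / 2 ^ K" .
  have cv_lt: "c * v < 2 ^ K"
  proof -
    have "c * v \<le> c * m" using v by (intro mult_left_mono) auto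
    then show ?thesis using split R_pos by linarith
  qed
  have "2 ^ K \<le> 2 * (c * v)"
  proof -
    have "c * (m + 1) \<le> c * (2 * v)" using v by (intro mult_left_mono) auto
    then show ?thesis using split m_le_c R_less_m by (simp add: algebra_simps)
  qed
  moreover obtain K' where K': "K = Suc K'" using K k by (cases K) auto
  ultimately have cv_ge: "2 ^ K' \<le> c * v" by simp
  have cv_pos: "0 < c * v" using cv_ge by (metis gr_zeroI le_zero_eq power_not_zero zero_neq_numeral)
  have R_q: "real R = 2 ^ K * q" by (simp add: q_def)
  have vm: "0 < real v / real m" using v m_pos by simp
  have "real v / real m * (excess K R - 2 * real R) < real v / real m * (2 ^ K * bent q)"
    using excess_less_bent[OF R_pos R_less] vm by (intro mult_strict_left_mono) (auto simp: q_def)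
  then have "real v / real m * (excess K R - 2 * real R) + (1 - real v / real m) * (real R * 2 ^ k)
     < real v / real m * (2 ^ K * bent q) + u * (real R * 2 ^ k)" by (simp add: u_def)
  also have "real v / real m * (2 ^ K * bent q) + u * (real R * 2 ^ k)
     = 2 ^ K * ((1 - u) * bent q + u * \<theta>)"
    using R_q by (simp add: u_def \<theta>_def algebra_simps)
  also have "\<dots> \<le> slack (c * v)"
    using good
  proof
    assume "0 \<le> psi q \<theta> (1 - real v / real m)"
    then have "(1 - u) * bent q + u * \<theta> \<le> bent t - 2 * t"
      by (simp add: psi_def u_def t_def)
    then have "2 ^ K * ((1 - u) * bent q + u * \<theta>) \<le> 2 ^ K * (bent t - 2 * t)"
      by (intro mult_left_mono) auto
    also have "\<dots> < slack (c * v)"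
      using slack_gt_bent[OF cv_pos cv_lt] unfolding t[symmetric] by simp
    finally show ?thesis by (rule less_imp_le)
  next
    assume "0 \<le> lin q \<theta> (1 - real v / real m)"
    then have "(1 - u) * bent q + u * \<theta> \<le> 3 / 2 - (1 - u) * (1 - q) * log 2 3"
      by (simp add: lin_def u_def)
    also have "(1 - u) * (1 - q) = real (c * v) / 2 ^ K"
      using t by (simp add: t_def algebra_simps)
    finally have "2 ^ K * ((1 - u) * bent q + u * \<theta>) \<le> 2 ^ K * (3 / 2 - real (c * v) / 2 ^ K * log 2 3)"
      by (intro mult_left_mono) auto
    also have "\<dots> \<le> slack (c * v)"
      using slack_ge_line[OF cv_ge] cv_lt by (simp only: K')
    finally show ?thesis .
  qed
  finally show ?thesis .
qed

lemma u_ge: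
  assumes "v < m"
  shows "2 powr - real k \<le> 1 - real v / real m"
proof -
  have "2 powr - real k = 1 / 2 ^ k" by (simp add: powr_minus powr_realpow field_simps)
  also have "\<dots> \<le> 1 / real m"
    using m_lt m_pos by (intro divide_left_mono) (auto simp flip: of_nat_power_less_of_nat_cancel_iff intro: less_imp_le)
  also have "1 / real m \<le> (real m - real v) / real m"
    using assms by (intro divide_right_mono) auto
  also have "\<dots> = 1 - real v / real m" using m_pos by (simp add: field_simps)
  finally show ?thesis .
qed

lemma theta_eq: "\<theta> = 2 ^ k * real R / 2 ^ K"
  by (simp add: \<theta>_def q_def)

text \<open>\<open>R\<close> is below \<open>2 ^ k\<close>, and each digit of precision beyond
  \<open>2 * k\<close> halves the bound on \<open>\<theta>\<close>. So
  \<open>\<theta> \<ge> 1 / 2\<close> forces \<open>K = 2 * k\<close>.\<close>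

lemma theta_less: "\<theta> * 2 ^ j < 1" if "2 * k + j \<le> K"
proof -
  have "real R < 2 ^ k" using R_less_m m_lt
    by (metis less_trans of_nat_less_numeral_power_cancel_iff)
  then have "2 ^ k * real R * 2 ^ j < 2 ^ k * 2 ^ k * 2 ^ j" by simp
  also have "\<dots> = 2 ^ (2 * k + j)" by (simp add: mult_2 power_add)
  also have "\<dots> \<le> (2::real) ^ K" using that by (intro power_increasing) auto
  finally show ?thesis by (simp add: theta_eq field_simps)
qed

lemma two_le_k: "2 \<le> k"
proof (rule ccontr)
  assume "\<not> 2 \<le> k"
  with k have "k = 1" by simp
  then show False using m_gt m_lt by simp
qed

lemma K_eq_of_theta: "K = 2 * k" if "1 / 2 \<le> \<theta>"
  using theta_less[of 1] that K by (cases "K = 2 * k") auto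

text \<open>For \<open>k\<close> from 4 to 6 a \<open>\<theta>\<close> above 9/16 fixes
  \<open>K\<close>, and the remainders are enumerated. Only \<open>K = 6\<close> with
  \<open>m\<close> equal to 5 or 6, where \<open>\<theta>\<close> is 1/2, is settled by computing
  slacks.\<close>

lemma item:
  assumes v: "m < 2 * v" "v < m"
  shows "real v / real m * (excess K R - 2 * real R) + (1 - real v / real m) * (real R * 2 ^ k)
    < slack (c * v)"
proof -
  define u where "u = 1 - real v / real m"
  have u: "2 powr - real k \<le> u" "u < 1"
    using u_ge[OF v(2)] v m_pos by (auto simp: u_def)
  note basic = q_bounds
  have \<theta>1: "\<theta> \<le> 1" using theta_less[of 0] K by simp
  have goal_if: ?thesis if "0 \<le> psi q \<theta> u \<or> 0 \<le> lin q \<theta> u"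
    using item_of_psi_or_lin[OF v] that by (simp add: u_def)
  have k_cases: "k = 2 \<or> k = 3 \<or> k = 4 \<or> k = 5 \<or> k = 6 \<or> 7 \<le> k"
    using two_le_k by linarith
  have K_three: "k = 3 \<longrightarrow> K = 6 \<or> 7 \<le> K" using K by linarith
  have \<theta>_cases: "\<theta> \<le> 9 / 16 \<or> 9 / 16 < \<theta>" by linarith
  have "7 \<le> k \<or> 4 \<le> k \<and> \<theta> \<le> 9 / 16 \<or> k = 6 \<and> 9 / 16 < \<theta> \<or> k = 5 \<and> 9 / 16 < \<theta>
    \<or> k = 4 \<and> 9 / 16 < \<theta> \<or> k = 3 \<and> K = 6 \<and> m \<noteq> 7 \<or> k = 3 \<and> K = 6 \<and> m = 7
    \<or> k = 3 \<and> 7 \<le> K \<or> k = 2"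
    using k_cases
  proof (elim disjE)
    assume "k = 3"
    with K_three show ?thesis by blast
  qed (use \<theta>_cases in \<open>(simp, linarith?)+\<close>)
  then consider "7 \<le> k" | "4 \<le> k" "\<theta> \<le> 9 / 16" | "k = 6" "9 / 16 < \<theta>" | "k = 5" "9 / 16 < \<theta>"
    | "k = 4" "9 / 16 < \<theta>" | "k = 3" "K = 6" "m \<noteq> 7" | "k = 3" "K = 6" "m = 7" | "k = 3" "7 \<le> K"
    | "k = 2"
    by blast
  then show ?thesis
  proof cases
    case 1
    show ?thesis
      using psi_or_lin_large[OF basic 1 \<theta>_def \<theta>1 u] by (rule goal_if)
  next
    case 2
    show ?thesis
      using psi_or_lin_medium[OF basic 2(1) \<theta>_def 2(2) u] by (rule goal_if)
  next
    case 3
    have K12: "K = 12" using K_eq_of_theta 3 by simp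
    have mem: "m \<in> set [33..<64]" unfolding set_upt using m_gt m_lt 3(1) by simp
    have "\<forall>m\<in>set [33..<64]. (4096::nat) mod m \<le> 50" by simp
    from this[rule_format, OF mem] have "R \<le> 50" using 3(1) K12 by (simp add: R_eq)
    then have "\<theta> \<le> 25 / 32" unfolding theta_eq using 3(1) K12 by simp
    then have "0 \<le> psi q \<theta> u \<or> 0 \<le> lin q \<theta> u"
      using psi_or_lin_six[OF basic _ \<theta>_def _ u] 3 by simp
    then show ?thesis by (rule goal_if)
  next
    case 4
    have K10: "K = 10" using K_eq_of_theta 4 by simp
    have R18: "18 < R" using 4 K10 unfolding theta_eq by simp
    have mem: "m \<in> set [17..<32]" unfolding set_upt using m_gt m_lt 4(1) by simp
    have "\<forall>m\<in>set [17..<32]. 18 < (1024::nat) mod m \<longrightarrow> m = 25 \<or> m = 27" by simp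
    from this[rule_format, OF mem] have m: "m = 25 \<or> m = 27" using 4(1) K10 R18 by (simp add: R_eq)
    \<comment> \<open>The neighbours of the gap are 5/25 and 6/25 for \<open>m = 25\<close>, and
      6/27 = 2/9 and 7/27 for \<open>m = 27\<close>.\<close>
    have "u \<le> 2 / 9 \<or> 6 / 25 \<le> u"
    proof (cases "m = 25")
      case True
      have "v \<le> 19 \<or> 20 \<le> v" by linarith
      then have "real v \<le> 19 \<or> 20 \<le> real v" by linarith
      then show ?thesis using True by (auto simp: u_def)
    next
      case False
      have "v \<le> 20 \<or> 21 \<le> v" by linarith
      then have "real v \<le> 20 \<or> 21 \<le> real v" by linarith
      then show ?thesis using False m by (auto simp: u_def)
    qed
    moreover have "R \<le> 25" using m K10 by (auto simp: R_eq)
    then have "\<theta> \<le> 25 / 32" using 4 K10 unfolding theta_eq by simp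
    ultimately have "0 \<le> psi q \<theta> u \<or> 0 \<le> lin q \<theta> u"
      using psi_or_lin_five[OF basic _ \<theta>_def _ u] 4 by simp
    then show ?thesis by (rule goal_if)
  next
    case 5
    have K8: "K = 8" using K_eq_of_theta 5 by simp
    have mem: "m \<in> set [9..<16]" unfolding set_upt using m_gt m_lt 5(1) by simp
    have "\<forall>m\<in>set [9..<16]. (256::nat) mod m \<le> 9" by simp
    from this[rule_format, OF mem] have "R \<le> 9" using 5(1) K8 by (simp add: R_eq)
    then show ?thesis using 5 K8 unfolding theta_eq by simp
  next
    case 6
    have m: "m = 5 \<or> m = 6" using 6 m_gt m_lt by auto
    have R: "R = 4" using m 6 by (auto simp: R_eq)
    have bw: "bit_weight 4 = 8" "bit_weight 36 = 168" "bit_weight 48 = 224" "bit_weight 40 = 184"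
      "bit_weight 50 = 226" 
      using bit_weight_rec[of 50] bit_weight_rec[of 25] bit_weight_rec[of 12] bit_weight_rec[of 6]
        bit_weight_rec[of 3] bit_weight_rec[of 1] bit_weight_rec[of 40] bit_weight_rec[of 20]
        bit_weight_rec[of 10] bit_weight_rec[of 5] bit_weight_rec[of 2] bit_weight_rec[of 48]
        bit_weight_rec[of 24] bit_weight_rec[of 36] bit_weight_rec[of 18] bit_weight_rec[of 9]
        bit_weight_rec[of 4] by simp_all
    have l: "84 / 53 \<le> log 2 (3::real)" "log 2 (3::real) \<le> 65 / 41" "log 2 (5::real) \<le> 7 / 3"
      "23 / 10 \<le> log 2 (5::real)"
      using log2_bounds log2_ge[of 5 10 23] by simp_all
    have lg: "log 2 60 = 2 + log 2 3 + log 2 (5::real)" "log 2 36 = 2 + 2 * log 2 (3::real)"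
      "log 2 48 = 4 + log 2 (3::real)" "log 2 40 = 3 + log 2 (5::real)"
      "log 2 50 = 1 + 2 * log 2 (5::real)"
      using log_mult[of 2 4 15] log_mult[of 2 3 5] log_mult[of 2 4 9] log_mult[of 2 3 3]
        log_mult[of 2 16 3] log_mult[of 2 8 5] log_mult[of 2 2 25] log_mult[of 2 5 5] by simp_all
    have ex: "excess K R - 2 * real R \<le> 16"
      using l by (simp add: excess_def R 6 bw lg)
    have sl: "32 < slack 36" "32 < slack 48" "32 < slack 40" "32 < slack 50"
      using l by (simp_all add: slack_def bw lg)
    \<comment> \<open>\<open>R * 2 ^ k\<close> is 32 and the other averaged quantity is at most 16,
      so it suffices that all four slacks exceed 32.\<close>
    have "real v / real m * (excess K R - 2 * real R) + (1 - real v / real m) * (real R * 2 ^ k)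
      \<le> real v / real m * 32 + (1 - real v / real m) * 32"
      using ex v m_pos by (intro add_mono mult_left_mono) (auto simp: R 6)
    also have "\<dots> = 32" by (simp add: algebra_simps)
    also have "32 < slack (c * v)"
    proof (cases "m = 5")
      case True
      then have "v = 3 \<or> v = 4" "c = 12" using v 6 by (auto simp: c_eq)
      then show ?thesis using sl by auto
    next
      case False
      then have "v = 4 \<or> v = 5" "c = 10" using v 6 m by (auto simp: c_eq)
      then show ?thesis using sl by auto
    qed
    finally show ?thesis .
  next
    case 7
    have "\<theta> \<le> 1 / 4" unfolding theta_eq using 7 by (simp add: R_eq)
    moreover from this have "q \<le> 1 / 32" using 7(1) unfolding \<theta>_def by simp
    ultimately have "0 \<le> psi q \<theta> u \<or> 0 \<le> lin q \<theta> u"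
      using q_bounds u 7 by (intro psi_or_lin_three) (auto simp: powr_minus)
    then show ?thesis by (rule goal_if)
  next
    case 8
    have "\<theta> \<le> 1 / 4"
    proof (cases "K = 7")
      case True
      have mem: "m \<in> set [5..<8]" unfolding set_upt using m_gt m_lt 8(1) by simp
      have "\<forall>m\<in>set [5..<8]. (128::nat) mod m \<le> 4" by simp
      from this[rule_format, OF mem] have "R \<le> 4" using 8(1) True by (simp add: R_eq)
      then show ?thesis unfolding theta_eq using 8 True by simp
    next
      case False
      then show ?thesis using theta_less[of 2] 8 by simp
    qed
    moreover from this have "q \<le> 1 / 32" using 8(1) unfolding \<theta>_def by simp
    ultimately have "0 \<le> psi q \<theta> u \<or> 0 \<le> lin q \<theta> u"
      using q_bounds u 8 by (intro psi_or_lin_three) (auto simp: powr_minus)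
    then show ?thesis by (rule goal_if)
  next
    case 9
    have m: "m = 3" using 9 m_gt m_lt by simp
    have v2: "v = 2" using v m by simp
    consider "K = 4" | "K = 5" | "6 \<le> K" using K 9 by linarith
    then have "\<theta> \<le> 1 / 4"
    proof cases
      case 1
      then show ?thesis unfolding theta_eq using 9 m by (simp add: R_eq)
    next
      case 2
      then show ?thesis unfolding theta_eq using 9 m by (simp add: R_eq)
    next
      case 3
      then show ?thesis using theta_less[of 2] 9 by simp
    qed
    moreover from this have "q \<le> 1 / 16" using 9 unfolding \<theta>_def by simp
    ultimately have "0 \<le> lin q \<theta> u"
      using q_bounds u m v2 by (intro lin_two) (auto simp: u_def)
    then show ?thesis using goal_if by blast
  qed
qed

lemma item_le:
  assumes "m < 2 * v" "v \<le> m"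
  shows "real v / real m * (excess K R - 2 * real R) + (1 - real v / real m) * (real R * 2 ^ k)
    < slack (c * v)"
proof (cases "v = m")
  case True
  have "c * m = 2 ^ K - R" using split by simp
  then show ?thesis using slack_complement_ge[OF R_pos R_less] True m_pos by simp
next
  case False
  then show ?thesis using item assms by simp
qed

end

section \<open>Scaling the items and summing their slacks\<close>

lemma ceiling_log2_bracket:
  assumes "0 < m" "k = nat \<lceil>log 2 (real m)\<rceil>"
  shows "m \<le> 2 ^ k" "0 < k \<Longrightarrow> 2 ^ (k - 1) < m"
proof -
  have l: "0 \<le> log 2 (real m)" using assms by simp
  then have "log 2 (real m) \<le> real k" using assms by linarith
  then have "real m \<le> 2 powr real k" using assms by (subst log_le_iff[symmetric]) auto
  then have "real m \<le> real (2 ^ k)" by (simp add: powr_realpow)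
  then show "m \<le> 2 ^ k" by (simp only: of_nat_le_iff)
  assume "0 < k"
  then have "real (k - 1) < log 2 (real m)" using assms l by linarith
  then have "2 powr real (k - 1) < real m" using assms by (subst less_log_iff[symmetric]) auto
  then have "real (2 ^ (k - 1)) < real m" by (simp add: powr_realpow)
  then show "2 ^ (k - 1) < m" by (simp only: of_nat_less_iff)
qed

lemma ex_power2_odd: "0 < (m::nat) \<Longrightarrow> \<exists>r m'. m = 2 ^ r * m' \<and> odd m'"
proof (induction m rule: less_induct)
  case (less m)
  show ?case
  proof (cases "odd m")
    case True
    then show ?thesis by (intro exI[of _ 0] exI[of _ m]) simp
  next
    case False
    then obtain x where x: "m = 2 * x" by blast
    then have "x < m" "0 < x" using less.prems by auto
    from less.IH[OF this] obtain r m' where "x = 2 ^ r * m'" "odd m'" by blast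
    with x show ?thesis by (intro exI[of _ "Suc r"] exI[of _ m']) simp
  qed
qed

lemma slack_sum_gt:
  fixes a :: "nat \<Rightarrow> nat"
  assumes pos: "\<And>i. i \<in> {1..n} \<Longrightarrow> 0 < a i" and gcd: "Gcd (a ` {1..n}) = 1"
    and m: "m = (\<Sum>i=1..n. a i)" and k: "k = nat \<lceil>log 2 (real m)\<rceil>" and K: "2 * k \<le> K"
  shows "excess K (2 ^ K mod m) < (\<Sum>i=1..n. slack (2 ^ K div m * a i))"
proof -
  have ne: "{1..n} \<noteq> {}" using gcd by (intro notI) simp
  have m_pos: "0 < m" unfolding m using pos ne by (intro sum_pos) auto
  have m_le: "m \<le> 2 ^ k" using ceiling_log2_bracket(1)[OF m_pos k] .
  also have "\<dots> \<le> 2 ^ K" using K by (intro power_increasing) auto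
  finally have c_pos: "0 < 2 ^ K div m" using m_pos by (simp add: div_greater_zero_iff)
  show ?thesis
  proof (cases "2 ^ K mod m = 0")
    case True
    then show ?thesis using ne c_pos pos by (auto intro!: sum_pos slack_pos)
  next
    case False
    have "m \<noteq> 2 ^ j" if "j \<le> K" for j
      using False le_imp_power_dvd[OF that, of "2::nat"] by auto
    moreover have "j \<le> K" if "m = 2 ^ j" for j
      using m_le K that by simp
    ultimately have not_pow: "m \<noteq> 2 ^ j" for j by blast
    have k0: "0 < k" using not_pow[of 0] m_le m_pos by (cases k) auto
    interpret aldr_denominator m k K "2 ^ K div m" "2 ^ K mod m"
      using k0 ceiling_log2_bracket(2)[OF m_pos k] m_le not_pow[of k] K False
      by unfold_locales auto
    define c where "c = 2 ^ K div m"
    define R where "R = 2 ^ K mod m"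
    have "\<exists>j. 2 ^ j * a i \<le> m \<and> m < 2 * (2 ^ j * a i)" if i: "i \<in> {1..n}" for i
    proof -
      have "a i \<le> m" unfolding m using i by (intro member_le_sum) auto
      then have "0 < m div a i" using pos[OF i] by (simp add: div_greater_zero_iff)
      then obtain j where j: "2 ^ j \<le> m div a i" "m div a i < 2 ^ Suc j"
        using ex_power2_bracket by blast
      have "2 ^ j * a i \<le> m" using j(1) pos[OF i] by (simp add: less_eq_div_iff_mult_less_eq)
      moreover have "m < 2 ^ Suc j * a i" using j(2) pos[OF i] by (simp add: div_less_iff_less_mult)
      ultimately show ?thesis by auto
    qed
    then obtain j where j: "\<And>i. i \<in> {1..n} \<Longrightarrow> 2 ^ j i * a i \<le> m"
      "\<And>i. i \<in> {1..n} \<Longrightarrow> m < 2 * (2 ^ j i * a i)" by metis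
    \<comment> \<open>This makes \<open>2 ^ (k - 1) * w i\<close> an integer, so the sum of the
      \<open>w i\<close> exceeds 1 by at least \<open>1 / 2 ^ (k - 1)\<close>.\<close>
    have jk: "j i \<le> k - 1" if i: "i \<in> {1..n}" for i
    proof -
      have "2 ^ j i * 1 \<le> 2 ^ j i * a i" using pos[OF i] by (intro mult_left_mono) auto
      then have "(2::nat) ^ j i < 2 ^ k" using j(1)[OF i] m_lt by linarith
      then show ?thesis using k0 by simp
    qed
    define w where "w i = 1 / (2::real) ^ j i" for i
    define p where "p i = real (a i) / real m" for i
    define X where "X = excess K R - 2 * real R"
    define Y where "Y = real R * 2 ^ k"
    have sum_p: "(\<Sum>i=1..n. p i) = 1"
    proof -
      have "(\<Sum>i=1..n. p i) = real (\<Sum>i=1..n. a i) / real m" by (simp add: p_def sum_divide_distrib)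
      then show ?thesis unfolding m[symmetric] using m_pos by simp
    qed
    have "\<exists>i\<in>{1..n}. 2 ^ j i * a i \<noteq> m"
    proof (rule ccontr)
      assume "\<not> ?thesis"
      then have eq: "2 ^ j i * a i = m" if "i \<in> {1..n}" for i using that by auto
      \<comment> \<open>The odd part of \<open>m\<close> would divide every \<open>a i\<close>,
        hence be 1, and \<open>m\<close> would be a power of two, against the nonzero
        remainder.\<close>
      obtain m' r where m': "m = 2 ^ r * m'" "odd m'"
        using ex_power2_odd[OF m_pos] by blast
      have "m' dvd a i" if "i \<in> {1..n}" for i
      proof -
        have "m' dvd 2 ^ j i * a i" using eq[OF that] m'(1) by simp
        moreover have "coprime m' (2 ^ j i)" using m'(2) by simp
        ultimately show ?thesis by (simp add: coprime_dvd_mult_right_iff)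
      qed
      then have "m' dvd Gcd (a ` {1..n})" by (intro Gcd_greatest) auto
      then have "m' = 1" using gcd by simp
      then show False using m' not_pow[of r] by simp
    qed
    then obtain i0 where i0: "i0 \<in> {1..n}" "2 ^ j i0 * a i0 < m" using j(1) by (metis le_neq_implies_less)
    have pw: "p i \<le> w i" if "i \<in> {1..n}" for i
    proof -
      have "real (2 ^ j i * a i) \<le> real m" using j(1)[OF that] by (simp only: of_nat_le_iff)
      then show ?thesis using m_pos by (simp add: p_def w_def field_simps)
    qed
    have "p i0 < w i0"
    proof -
      have "real (2 ^ j i0 * a i0) < real m" using i0(2) by (simp only: of_nat_less_iff)
      then show ?thesis using m_pos by (simp add: p_def w_def field_simps)
    qed
    then have "(\<Sum>i=1..n. p i) < (\<Sum>i=1..n. w i)"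
      using pw i0 by (intro sum_strict_mono_ex1) auto
    then have "1 < (\<Sum>i=1..n. w i)" unfolding sum_p .
    then have "2 ^ (k - 1) * 1 < 2 ^ (k - 1) * (\<Sum>i=1..n. w i)"
      by (intro mult_strict_left_mono) auto
    also have W: "2 ^ (k - 1) * (\<Sum>i=1..n. w i) = real (\<Sum>i=1..n. 2 ^ (k - 1 - j i))"
      unfolding sum_distrib_left of_nat_sum
    proof (intro sum.cong refl)
      fix i assume "i \<in> {1..n}"
      then show "2 ^ (k - 1) * w i = real (2 ^ (k - 1 - j i))"
        using power_diff[of "2::real" "j i" "k - 1"] jk by (simp add: w_def)
    qed
    finally have "real (2 ^ (k - 1)) < real (\<Sum>i=1..n. 2 ^ (k - 1 - j i))" by simp
    then have "2 ^ (k - 1) < (\<Sum>i=1..n. 2 ^ (k - 1 - j i) :: nat)"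
      by (simp only: of_nat_less_iff)
    then have "2 ^ (k - 1) + 1 \<le> (\<Sum>i=1..n. 2 ^ (k - 1 - j i) :: nat)" by linarith
    then have "real (2 ^ (k - 1) + 1) \<le> real (\<Sum>i=1..n. 2 ^ (k - 1 - j i))"
      by (simp only: of_nat_le_iff)
    then have "2 ^ (k - 1) + 1 \<le> 2 ^ (k - 1) * (\<Sum>i=1..n. w i)" unfolding W by simp
    then have U: "1 \<le> 2 ^ (k - 1) * ((\<Sum>i=1..n. w i) - 1)" by (simp add: algebra_simps)
    have "2 * real R * 1 \<le> 2 * real R * (2 ^ (k - 1) * ((\<Sum>i=1..n. w i) - 1))"
      using U by (intro mult_left_mono) auto
    also have "\<dots> = Y * ((\<Sum>i=1..n. w i) - 1)"
      using k0 by (cases k) (simp_all add: Y_def)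
    finally have YU: "2 * real R \<le> Y * ((\<Sum>i=1..n. w i) - 1)" by simp
    have item_i: "p i * X + (w i - p i) * Y < slack (c * a i)" if i: "i \<in> {1..n}" for i
    proof -
      define v where "v = 2 ^ j i * a i"
      have "real v / real m * X + (1 - real v / real m) * Y < slack (c * v)"
        using item_le[of v] j[OF i] by (simp add: v_def X_def Y_def c_def R_def)
      also have "slack (c * v) = 2 ^ j i * slack (c * a i)"
        using slack_power[of "j i" "c * a i"] by (simp add: v_def ac_simps)
      \<comment> \<open>Multiplying by \<open>w i\<close> undoes the scaling. The coefficients of
        \<open>X\<close> then add up to 1 and those of \<open>Y\<close> to U.\<close>
      finally have "w i * (real v / real m * X + (1 - real v / real m) * Y)
        < w i * (2 ^ j i * slack (c * a i))"
        by (intro mult_strict_left_mono) (auto simp: w_def)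
      moreover have "w i * (real v / real m) = p i" by (simp add: w_def v_def p_def)
      then have "w i * (real v / real m * X + (1 - real v / real m) * Y) = p i * X + (w i - p i) * Y"
        by (simp only: distrib_left left_diff_distrib right_diff_distrib mult.assoc[symmetric])
      moreover have "w i * (2 ^ j i * slack (c * a i)) = slack (c * a i)" by (simp add: w_def)
      ultimately show ?thesis by simp
    qed
    have "excess K R \<le> X + Y * ((\<Sum>i=1..n. w i) - 1)" using YU by (simp add: X_def)
    also have "\<dots> = (\<Sum>i=1..n. p i * X + (w i - p i) * Y)"
      unfolding sum.distrib sum_distrib_right[symmetric] sum_subtractf sum_p by (simp add: algebra_simps)
    also have "\<dots> < (\<Sum>i=1..n. slack (c * a i))"
      using item_i ne by (intro sum_strict_mono) auto
    finally show ?thesis by (simp add: c_def R_def)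
  qed
qed

section \<open>Random walks on DDG trees\<close>

text \<open>The current state is kept apart from the root \<open>rt\<close> to allow induction over
  subtrees.\<close>

primrec walk_from :: "'a ddg \<Rightarrow> 'a ddg \<Rightarrow> bool stream \<Rightarrow> nat \<Rightarrow> 'a ddg" where
  "walk_from rt s \<omega> 0 = s"
| "walk_from rt s \<omega> (Suc t) = ddg_step rt (walk_from rt s \<omega> t) (\<omega> !! t)"

lemma ddg_walk_eq: "ddg_walk T \<omega> t = walk_from T T \<omega> t"
  by (induction t) simp_all

lemma walk_from_Cons:
  "walk_from rt s (b ## \<omega>) (Suc t) = walk_from rt (ddg_step rt s b) \<omega> t"
  by (induction t) simp_all

text \<open>The state depends on finitely many bits, which yields measurability.\<close>

lemma walk_from_stake: "walk_from rt s \<omega> t = foldl (ddg_step rt) s (stake t \<omega>)"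
proof (induction t arbitrary: s \<omega>)
  case (Suc t)
  obtain b \<omega>' where "\<omega> = b ## \<omega>'" by (metis stream.collapse)
  with Suc show ?case by (simp add: walk_from_Cons del: walk_from.simps(2))
qed simp

lemma walk_from_Leaf: "walk_from rt (Leaf j) \<omega> t = Leaf j"
  by (induction t) simp_all

lemma walk_from_Leaf_stays:
  "walk_from rt s \<omega> t = Leaf j \<Longrightarrow> t \<le> t' \<Longrightarrow> walk_from rt s \<omega> t' = Leaf j"
  by (induction t' rule: nat_induct) (auto simp: le_Suc_eq)

lemma space_fair_bits [simp]: "space fair_bits = UNIV"
  by (simp add: fair_bits_def space_stream_space)

lemma sets_fair_bits [measurable_cong]:
  "sets fair_bits = sets (stream_space (count_space UNIV))"
  unfolding fair_bits_def by (intro sets_stream_space_cong) simp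

lemma prob_space_fair_bits: "prob_space fair_bits"
  unfolding fair_bits_def by (rule prob_space.prob_space_stream_space) (rule measure_pmf.prob_space_axioms)

lemma sets_walk_from [measurable]: "{\<omega>. P (walk_from rt s \<omega> t)} \<in> sets fair_bits"
proof -
  have "(\<lambda>\<omega>. P (foldl (ddg_step rt) s (stake t \<omega>))) \<in> measurable fair_bits (count_space UNIV)"
    by measurable
  then have "{\<omega> \<in> space fair_bits. P (foldl (ddg_step rt) s (stake t \<omega>))} \<in> sets fair_bits"
    by measurable
  then show ?thesis by (simp add: walk_from_stake)
qed

lemma measure_fair_bits_split:
  assumes "X \<in> sets fair_bits"
  shows "measure fair_bits X
    = (measure fair_bits {\<omega>. True ## \<omega> \<in> X} + measure fair_bits {\<omega>. False ## \<omega> \<in> X}) / 2"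
proof -
  interpret fb: prob_space fair_bits by (rule prob_space_fair_bits)
  have "emeasure fair_bits X
    = (\<integral>\<^sup>+b. emeasure fair_bits {\<omega>. b ## \<omega> \<in> X} \<partial>measure_pmf (bernoulli_pmf (1/2)))"
    using prob_space.emeasure_stream_space[OF measure_pmf.prob_space_axioms, of X "bernoulli_pmf (1/2)"] assms
    by (simp add: fair_bits_def[symmetric])
  also have "\<dots> = emeasure fair_bits {\<omega>. True ## \<omega> \<in> X} * ennreal (1/2)
      + emeasure fair_bits {\<omega>. False ## \<omega> \<in> X} * ennreal (1/2)"
    by (subst nn_integral_bernoulli_pmf) auto
  also have "\<dots> = ennreal ((measure fair_bits {\<omega>. True ## \<omega> \<in> X} + measure fair_bits {\<omega>. False ## \<omega> \<in> X}) / 2)"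
    unfolding fb.emeasure_eq_measure
    by (subst (1 2) ennreal_mult''[symmetric], simp, simp, subst ennreal_plus[symmetric])
      (simp_all add: add_divide_distrib)
  finally show ?thesis unfolding fb.emeasure_eq_measure by (simp add: measure_nonneg)
qed

text \<open>A walk enters a child with its back edge already resolved, so the equations for subtrees
  are stated for \<open>jump rt s\<close>.\<close>

definition jump :: "'a ddg \<Rightarrow> 'a ddg \<Rightarrow> 'a ddg" where
  "jump rt s = (case s of Back \<Rightarrow> rt | _ \<Rightarrow> s)"

lemma jump_simps [simp]:
  "jump rt (Leaf j) = Leaf j" "jump rt Back = rt" "jump rt (Node l r) = Node l r" "jump rt rt = rt"
  by (auto simp: jump_def split: ddg.split)

lemma ddg_step_Node: "ddg_step rt (Node l r) b = jump rt (if b then r else l)"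
  by (simp add: jump_def split: ddg.split)

definition running :: "'a ddg \<Rightarrow> 'a ddg \<Rightarrow> nat \<Rightarrow> bool stream set" where
  "running rt s t = {\<omega>. \<forall>i. walk_from rt s \<omega> t \<noteq> Leaf i}"

definition emitting :: "'a \<Rightarrow> 'a ddg \<Rightarrow> 'a ddg \<Rightarrow> bool stream set" where
  "emitting i rt s = {\<omega>. \<exists>t. walk_from rt s \<omega> t = Leaf i}"

lemma sets_running [measurable]: "running rt s t \<in> sets fair_bits"
  unfolding running_def by (rule sets_walk_from)

lemma sets_emitting [measurable]: "emitting i rt s \<in> sets fair_bits"
proof -
  have "emitting i rt s = (\<Union>t. {\<omega>. walk_from rt s \<omega> t = Leaf i})" by (auto simp: emitting_def)
  then show ?thesis by (simp add: sets_walk_from sets.countable_UN)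
qed

abbreviation run_prob :: "'a ddg \<Rightarrow> 'a ddg \<Rightarrow> nat \<Rightarrow> real" where
  "run_prob rt s t \<equiv> measure fair_bits (running rt s t)"

lemma run_prob_Leaf: "run_prob rt (Leaf j) t = 0"
  by (simp add: running_def walk_from_Leaf)

lemma run_prob_Node_0: "run_prob rt (Node l r) 0 = 1"
  using prob_space.prob_space[OF prob_space_fair_bits] by (simp add: running_def)

lemma run_prob_Node_Suc:
  "run_prob rt (Node l r) (Suc t) = (run_prob rt (jump rt l) t + run_prob rt (jump rt r) t) / 2"
  by (subst measure_fair_bits_split[OF sets_running])
    (simp add: running_def walk_from_Cons ddg_step_Node del: walk_from.simps(2) ddg_step.simps(1))

lemma emit_prob_Leaf: "measure fair_bits (emitting i rt (Leaf j)) = (if j = i then 1 else 0)"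
  using prob_space.prob_space[OF prob_space_fair_bits] by (auto simp: emitting_def walk_from_Leaf)

lemma emit_prob_Node:
  "measure fair_bits (emitting i rt (Node l r))
    = (measure fair_bits (emitting i rt (jump rt l)) + measure fair_bits (emitting i rt (jump rt r))) / 2"
proof -
  have "b ## \<omega> \<in> emitting i rt (Node l r) \<longleftrightarrow> \<omega> \<in> emitting i rt (jump rt (if b then r else l))" for b \<omega>
  proof -
    have "(\<exists>t. walk_from rt (Node l r) (b ## \<omega>) t = Leaf i)
      \<longleftrightarrow> (\<exists>t. walk_from rt (Node l r) (b ## \<omega>) (Suc t) = Leaf i)"
      by (metis ddg.distinct(3) not0_implies_Suc walk_from.simps(1))
    then show ?thesis
      by (simp add: emitting_def walk_from_Cons ddg_step_Node del: walk_from.simps(2) ddg_step.simps(1))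
  qed
  then show ?thesis by (subst measure_fair_bits_split[OF sets_emitting]) simp
qed

text \<open>The mean of a reward \<open>c\<close> per bit, \<open>g j\<close> at a leaf labelled \<open>j\<close> and \<open>b\<close> at a back edge,
  for a single descent of the tree.\<close>

primrec descent_mean :: "real \<Rightarrow> ('a \<Rightarrow> real) \<Rightarrow> real \<Rightarrow> 'a ddg \<Rightarrow> real" where
  "descent_mean c g b (Leaf j) = g j"
| "descent_mean c g b Back = b"
| "descent_mean c g b (Node l r) = c + (descent_mean c g b l + descent_mean c g b r) / 2"

lemma descent_mean_affine:
  "descent_mean c g b s = descent_mean c g 0 s + b * descent_mean 0 (\<lambda>_. 0) 1 s"
  by (induction s) (auto simp: algebra_simps add_divide_distrib)

lemma descent_mean_mono:
  "b \<le> b' \<Longrightarrow> descent_mean c g b s \<le> descent_mean c g b' s"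
  by (induction s) auto

lemma descent_mean_nonneg:
  "0 \<le> b \<Longrightarrow> descent_mean 1 (\<lambda>_. 0) b s \<ge> 0"
  by (induction s) auto

lemma emit_prob_eq:
  "measure fair_bits (emitting i rt (jump rt s))
    = descent_mean 0 (\<lambda>j. if j = i then 1 else 0) (measure fair_bits (emitting i rt rt)) s"
  by (induction s) (simp_all add: emit_prob_Leaf emit_prob_Node)

text \<open>Truncated sums are finite without any convergence argument. A child has one bit less
  left, hence only an inequality.\<close>

lemma partial_cost_le:
  "(\<Sum>t<N. run_prob rt (jump rt s) t) \<le> descent_mean 1 (\<lambda>_. 0) (\<Sum>t<N. run_prob rt rt t) s"
proof (induction s arbitrary: N)
  case (Node l r)
  show ?case
  proof (cases N)
    case 0
    then show ?thesis using descent_mean_nonneg[of 0 "Node l r"] by simp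
  next
    case (Suc M)
    have mono: "descent_mean 1 (\<lambda>_. 0) (\<Sum>t<M. run_prob rt rt t) x
      \<le> descent_mean 1 (\<lambda>_. 0) (\<Sum>t<N. run_prob rt rt t) x" for x
      by (intro descent_mean_mono) (simp add: Suc)
    have "(\<Sum>t<N. run_prob rt (Node l r) t)
      = 1 + ((\<Sum>t<M. run_prob rt (jump rt l) t) + (\<Sum>t<M. run_prob rt (jump rt r) t)) / 2"
      unfolding Suc sum.lessThan_Suc_shift run_prob_Node_0 run_prob_Node_Suc
      by (simp add: sum.distrib sum_divide_distrib add_divide_distrib)
    also have "\<dots> \<le> descent_mean 1 (\<lambda>_. 0) (\<Sum>t<N. run_prob rt rt t) (Node l r)"
      using Node.IH(1)[of M] Node.IH(2)[of M] mono[of l] mono[of r] by simp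
    finally show ?thesis by simp
  qed
qed (simp_all add: run_prob_Leaf)

text \<open>With return probability \<beta> < 1, a partial sum S at the root satisfies S <= d +
  \<beta> S, where d is the mean length of one descent.\<close>

lemma summable_run_prob:
  assumes "descent_mean 0 (\<lambda>_. 0) 1 rt < 1"
  shows "summable (run_prob rt (jump rt s))"
proof -
  define \<beta> where "\<beta> = descent_mean 0 (\<lambda>_. 0) 1 rt"
  define B where "B = descent_mean 1 (\<lambda>_. 0) 0 rt / (1 - \<beta>)"
  have "(\<Sum>t<N. run_prob rt rt t) \<le> B" for N
  proof -
    have "(\<Sum>t<N. run_prob rt rt t) \<le> descent_mean 1 (\<lambda>_. 0) 0 rt + (\<Sum>t<N. run_prob rt rt t) * \<beta>"
      using partial_cost_le[of rt rt N] descent_mean_affine[of 1 "\<lambda>_. 0" "\<Sum>t<N. run_prob rt rt t" rt]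
      by (simp add: \<beta>_def)
    then show ?thesis using assms by (simp add: B_def \<beta>_def field_simps)
  qed
  then have "(\<Sum>t<N. run_prob rt (jump rt s) t) \<le> descent_mean 1 (\<lambda>_. 0) B s" for N
    using partial_cost_le[of rt s N] descent_mean_mono by (meson order_trans)
  then show ?thesis by (intro bounded_imp_summable[where B = "descent_mean 1 (\<lambda>_. 0) B s"])
      (simp_all only: lessThan_Suc_atMost[symmetric] measure_nonneg)
qed

lemma mean_cost_eq:
  assumes "descent_mean 0 (\<lambda>_. 0) 1 rt < 1"
  shows "(\<Sum>t. run_prob rt (jump rt s) t) = descent_mean 1 (\<lambda>_. 0) (\<Sum>t. run_prob rt rt t) s"
proof (induction s)
  case (Node l r)
  note sm = summable_run_prob[OF assms]
  have "(\<Sum>t. run_prob rt (Node l r) t)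
    = run_prob rt (Node l r) 0 + (\<Sum>t. run_prob rt (Node l r) (Suc t))"
    using suminf_split_head[OF sm[of "Node l r"]] by simp
  also have "(\<Sum>t. run_prob rt (Node l r) (Suc t))
    = ((\<Sum>t. run_prob rt (jump rt l) t) + (\<Sum>t. run_prob rt (jump rt r) t)) / 2"
    unfolding run_prob_Node_Suc suminf_add[OF sm sm] using summable_add[OF sm sm]
    by (intro suminf_divide)
  finally show ?case using Node.IH by (simp add: run_prob_Node_0)
qed (simp_all add: run_prob_Leaf)

text \<open>The cost counts the times at which no leaf has been reached, also if it is infinite; its
  expectation is then a sum of survival probabilities.\<close>

lemma ddg_cost_eq:
  "ennreal_of_enat (ddg_cost T \<omega>) = (\<Sum>t. indicator (running T T t) \<omega>)"
proof (cases "\<exists>t i. ddg_walk T \<omega> t = Leaf i")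
  case True
  define t0 where "t0 = (LEAST t. \<exists>i. ddg_walk T \<omega> t = Leaf i)"
  obtain i where i: "ddg_walk T \<omega> t0 = Leaf i"
    using LeastI_ex[OF True] unfolding t0_def by blast
  have "\<omega> \<in> running T T t \<longleftrightarrow> t < t0" for t
  proof (cases "t < t0")
    case True
    then show ?thesis using not_less_Least[of t "\<lambda>t. \<exists>i. ddg_walk T \<omega> t = Leaf i"]
      by (auto simp: t0_def running_def ddg_walk_eq)
  next
    case False
    then have "ddg_walk T \<omega> t = Leaf i"
      using walk_from_Leaf_stays[of T T \<omega> t0 i t] i by (simp add: ddg_walk_eq)
    with False show ?thesis by (auto simp: running_def ddg_walk_eq)
  qed
  then have "(\<Sum>t. indicator (running T T t) \<omega>) = (\<Sum>t<t0. 1 :: ennreal)"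
    by (subst suminf_finite[of "{..<t0}"]) (auto simp: indicator_def)
  with True show ?thesis by (simp add: ddg_cost_def t0_def[symmetric] ennreal_of_nat_eq_real_of_nat)
next
  case False
  then have "indicator (running T T t) \<omega> = (1 :: ennreal)" for t
    by (simp add: running_def ddg_walk_eq)
  then have "(\<Sum>t. indicator (running T T t) \<omega>) = (SUP N. of_nat N :: ennreal)"
    by (simp add: suminf_eq_SUP)
  with False show ?thesis by (simp add: ddg_cost_def ennreal_SUP_of_nat_eq_top)
qed

lemma ddg_expected_cost_eq:
  assumes "descent_mean 0 (\<lambda>_. 0) 1 T < 1"
  shows "ddg_expected_cost T = ereal (\<Sum>t. run_prob T T t)"
proof -
  interpret fb: prob_space fair_bits by (rule prob_space_fair_bits)
  have sm: "summable (run_prob T T)" using summable_run_prob[OF assms, of T] by simp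
  have "(\<integral>\<^sup>+\<omega>. ennreal_of_enat (ddg_cost T \<omega>) \<partial>fair_bits)
    = (\<Sum>t. \<integral>\<^sup>+\<omega>. indicator (running T T t) \<omega> \<partial>fair_bits)"
    unfolding ddg_cost_eq by (intro nn_integral_suminf) measurable
  also have "\<dots> = (\<Sum>t. ennreal (run_prob T T t))"
    by (simp add: fb.emeasure_eq_measure)
  also have "\<dots> = ennreal (\<Sum>t. run_prob T T t)"
    using sm by (intro suminf_ennreal2) auto
  finally show ?thesis
    using sm by (simp add: ddg_expected_cost_def enn2ereal_ennreal suminf_nonneg)
qed

section \<open>From leaf counts to digit weights\<close>

lemma descent_mean_zero_to_back:
  "descent_mean c g b (zero_to_back S) = descent_mean c (g(0 := b)) b' S" if "back_free S"
  using that by (induction S) auto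

text \<open>A leaf at depth \<open>d\<close> is reached with probability \<open>1 / 2 ^ d\<close>.
  The second equation is carried along because moving every leaf one level down adds
  \<open>c\<close> times the total probability. Any \<open>H\<close> not below the height of the
  tree works.\<close>

lemma descent_mean_leaves:
  assumes "finite I" "back_free S" "labels S \<subseteq> I"
  shows "\<exists>H. \<forall>D\<ge>H.
    (\<Sum>i\<in>I. \<Sum>d\<le>D. real (num_leaves S i d) * ((c * real d + g i) / 2 ^ d)) = descent_mean c g b S \<and>
    (\<Sum>i\<in>I. \<Sum>d\<le>D. real (num_leaves S i d) / 2 ^ d) = 1"
  using assms(2,3)
proof (induction S)
  case (Leaf j)
  have 1: "(\<Sum>d\<le>D. real (num_leaves (Leaf j) i d) * f d) = (if i = j then f 0 else 0)" for D i and f :: "nat \<Rightarrow> real"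
  proof -
    have "(\<Sum>d\<le>D. real (num_leaves (Leaf j) i d) * f d) = (\<Sum>d\<le>D. if d = 0 then (if i = j then f 0 else 0) else 0)"
      by (intro sum.cong) auto
    then show ?thesis by simp
  qed
  show ?case
  proof (intro exI[of _ 0] allI impI conjI)
    fix D :: nat
    have j: "j \<in> I" using Leaf by simp
    show "(\<Sum>i\<in>I. \<Sum>d\<le>D. real (num_leaves (Leaf j) i d) * ((c * real d + g i) / 2 ^ d))
      = descent_mean c g b (Leaf j)"
      unfolding 1 using j assms(1) by simp
    have "(\<Sum>i\<in>I. \<Sum>d\<le>D. real (num_leaves (Leaf j) i d) * (1 / 2 ^ d)) = 1"
      unfolding 1 using j assms(1) by simp
    then show "(\<Sum>i\<in>I. \<Sum>d\<le>D. real (num_leaves (Leaf j) i d) / 2 ^ d) = 1" by simp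
  qed
next
  case (Node l r)
  have bl: "back_free l" "labels l \<subseteq> I" and br: "back_free r" "labels r \<subseteq> I"
    using Node.prems by auto
  obtain Hl where Hl: "\<forall>D\<ge>Hl.
      (\<Sum>i\<in>I. \<Sum>d\<le>D. real (num_leaves l i d) * ((c * real d + g i) / 2 ^ d)) = descent_mean c g b l \<and>
      (\<Sum>i\<in>I. \<Sum>d\<le>D. real (num_leaves l i d) / 2 ^ d) = 1"
    using Node.IH(1)[OF bl] by (rule exE)
  obtain Hr where Hr: "\<forall>D\<ge>Hr.
      (\<Sum>i\<in>I. \<Sum>d\<le>D. real (num_leaves r i d) * ((c * real d + g i) / 2 ^ d)) = descent_mean c g b r \<and>
      (\<Sum>i\<in>I. \<Sum>d\<le>D. real (num_leaves r i d) / 2 ^ d) = 1"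
    using Node.IH(2)[OF br] by (rule exE)
  show ?case
  proof (intro exI[of _ "Suc (max Hl Hr)"] allI impI)
    fix D assume "Suc (max Hl Hr) \<le> D"
    then obtain E where E: "D = Suc E" "Hl \<le> E" "Hr \<le> E" by (cases D) auto
    note Hl1 = conjunct1[OF Hl[rule_format, OF E(2)]] conjunct2[OF Hl[rule_format, OF E(2)]]
    note Hr1 = conjunct1[OF Hr[rule_format, OF E(3)]] conjunct2[OF Hr[rule_format, OF E(3)]]
    have s: "(\<Sum>d\<le>D. real (num_leaves (Node l r) i d) * f d)
      = (\<Sum>d\<le>E. real (num_leaves l i d) * f (Suc d)) + (\<Sum>d\<le>E. real (num_leaves r i d) * f (Suc d))"
      for i and f :: "nat \<Rightarrow> real"
      unfolding E(1) sum.atMost_Suc_shift by (simp add: distrib_right sum.distrib)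
    have pt: "y * ((c * (1 + z) + v) / (2 * p)) = y * ((c * z + v) / p) / 2 + c / 2 * (y / p)" for y z v p :: real
      by (cases "p = 0") (simp_all add: divide_simps, simp add: algebra_simps)
    have h: "(\<Sum>i\<in>I. \<Sum>d\<le>E. real (num_leaves x i d) * ((c * real (Suc d) + g i) / 2 ^ Suc d))
       = (\<Sum>i\<in>I. \<Sum>d\<le>E. real (num_leaves x i d) * ((c * real d + g i) / 2 ^ d)) / 2
        + c / 2 * (\<Sum>i\<in>I. \<Sum>d\<le>E. real (num_leaves x i d) / 2 ^ d)" for x
    proof -
      have "(\<Sum>i\<in>I. \<Sum>d\<le>E. real (num_leaves x i d) * ((c * real (Suc d) + g i) / 2 ^ Suc d))
        = (\<Sum>i\<in>I. \<Sum>d\<le>E. real (num_leaves x i d) * ((c * real d + g i) / 2 ^ d) / 2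
            + c / 2 * (real (num_leaves x i d) / 2 ^ d))"
        unfolding of_nat_Suc power_Suc pt ..
      then show ?thesis
        by (simp only: sum.distrib sum_divide_distrib[symmetric] sum_distrib_left[symmetric])
    qed
    have h': "(\<Sum>i\<in>I. \<Sum>d\<le>E. real (num_leaves x i d) * inverse (2 ^ Suc d))
       = (\<Sum>i\<in>I. \<Sum>d\<le>E. real (num_leaves x i d) / 2 ^ d) / 2" for x
      unfolding divide_inverse power_Suc inverse_mult_distrib sum_distrib_right by (simp only: ac_simps)
    have "(\<Sum>i\<in>I. \<Sum>d\<le>D. real (num_leaves (Node l r) i d) * ((c * real d + g i) / 2 ^ d))
      = descent_mean c g b (Node l r)"
      unfolding s sum.distrib h Hl1 Hr1 by (simp add: add_divide_distrib)
    moreover have "(\<Sum>i\<in>I. \<Sum>d\<le>D. real (num_leaves (Node l r) i d) * inverse (2 ^ d)) = 1"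
      unfolding s sum.distrib h' Hl1 Hr1 by simp
    ultimately show "(\<Sum>i\<in>I. \<Sum>d\<le>D. real (num_leaves (Node l r) i d) * ((c * real d + g i) / 2 ^ d))
        = descent_mean c g b (Node l r) \<and>
      (\<Sum>i\<in>I. \<Sum>d\<le>D. real (num_leaves (Node l r) i d) / 2 ^ d) = 1"
      unfolding divide_inverse by (rule conjI)
  qed
qed simp

lemma digit_mean:
  assumes "A < 2 ^ Suc K"
  shows "(\<Sum>d\<le>K. real (A div 2 ^ (K - d) mod 2) * ((c * real d + x) / 2 ^ d))
    = ((c * real K + x) * real A - c * real (bit_weight A)) / 2 ^ K"
proof -
  have "(\<Sum>j\<le>K. (A div 2 ^ j mod 2) * 2 ^ j) = A"
    using binary_expansion[OF assms] sum.nat_diff_reindex[of "\<lambda>j. (A div 2 ^ j mod 2) * 2 ^ j" "Suc K"]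
    by (simp add: lessThan_Suc_atMost)
  then have "real (\<Sum>j\<le>K. (A div 2 ^ j mod 2) * 2 ^ j) = real A" by (simp only:)
  then have e: "(\<Sum>j\<le>K. real (A div 2 ^ j mod 2) * 2 ^ j) = real A" by simp
  have "real (\<Sum>j\<le>K. (A div 2 ^ j mod 2) * 2 ^ j * j) = real (bit_weight A)"
    unfolding bit_weight_digits[OF assms] ..
  then have w: "(\<Sum>j\<le>K. real (A div 2 ^ j mod 2) * 2 ^ j * real j) = real (bit_weight A)" by simp
  have "(\<Sum>d\<le>K. real (A div 2 ^ (K - d) mod 2) * ((c * real d + x) / 2 ^ d))
    = (\<Sum>j\<le>K. real (A div 2 ^ j mod 2) * ((c * real (K - j) + x) / 2 ^ (K - j)))"
    using sum.nat_diff_reindex[of "\<lambda>j. real (A div 2 ^ j mod 2) * ((c * real (K - j) + x) / 2 ^ (K - j))" "Suc K"]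
    by (simp add: lessThan_Suc_atMost)
  also have "\<dots> = (\<Sum>j\<le>K. ((c * real K + x) * (real (A div 2 ^ j mod 2) * 2 ^ j)
      - c * (real (A div 2 ^ j mod 2) * 2 ^ j * real j)) / 2 ^ K)"
    by (intro sum.cong refl) (simp add: power_diff of_nat_diff field_simps)
  also have "\<dots> = ((c * real K + x) * real A - c * real (bit_weight A)) / 2 ^ K"
    unfolding sum_divide_distrib[symmetric] sum_subtractf sum_distrib_left[symmetric] e w ..
  finally show ?thesis .
qed

lemma descent_mean_optimal:
  fixes B :: "nat \<Rightarrow> nat"
  assumes opt: "entropy_optimal_ddg n q S" and q: "\<And>i. i \<le> n \<Longrightarrow> q i = real (B i) / 2 ^ K"
    and B: "\<And>i. i \<le> n \<Longrightarrow> B i \<le> 2 ^ K"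
  shows "descent_mean c g b S
    = (\<Sum>i\<le>n. ((c * real K + g i) * real (B i) - c * real (bit_weight (B i))) / 2 ^ K)"
proof -
  have S: "back_free S" "labels S \<subseteq> {..n}"
    using opt by (auto simp: entropy_optimal_ddg_def)
  have nl: "num_leaves S i d = (if d \<le> K then B i div 2 ^ (K - d) mod 2 else 0)" if "i \<le> n" for i d
  proof -
    have "int (num_leaves S i d) = binary_digit (int d) (real (B i) / 2 ^ K)"
      using opt that q by (auto simp: entropy_optimal_ddg_def)
    then show ?thesis unfolding binary_digit_dyadic by (simp split: if_splits)
  qed
  obtain H where H: "\<forall>D\<ge>H.
    (\<Sum>i\<le>n. \<Sum>d\<le>D. real (num_leaves S i d) * ((c * real d + g i) / 2 ^ d)) = descent_mean c g b S \<and>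
    (\<Sum>i\<le>n. \<Sum>d\<le>D. real (num_leaves S i d) / 2 ^ d) = 1"
    using descent_mean_leaves[OF finite_atMost S] by (rule exE)
  have "descent_mean c g b S
    = (\<Sum>i\<le>n. \<Sum>d\<le>max H K. real (num_leaves S i d) * ((c * real d + g i) / 2 ^ d))"
    using H[rule_format, of "max H K"] by simp
  also have "\<dots> = (\<Sum>i\<le>n. \<Sum>d\<le>K. real (B i div 2 ^ (K - d) mod 2) * ((c * real d + g i) / 2 ^ d))"
  proof (rule sum.cong[OF refl])
    fix i assume "i \<in> {..n}"
    then show "(\<Sum>d\<le>max H K. real (num_leaves S i d) * ((c * real d + g i) / 2 ^ d))
      = (\<Sum>d\<le>K. real (B i div 2 ^ (K - d) mod 2) * ((c * real d + g i) / 2 ^ d))"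
      by (intro sum.mono_neutral_cong_right) (auto simp: nl)
  qed
  also have "\<dots> = (\<Sum>i\<le>n. ((c * real K + g i) * real (B i) - c * real (bit_weight (B i))) / 2 ^ K)"
  proof (rule sum.cong[OF refl])
    fix i assume "i \<in> {..n}"
    then have "B i < 2 ^ Suc K" using B[of i] by (simp add: le_less_trans[of _ "2 ^ K"])
    then show "(\<Sum>d\<le>K. real (B i div 2 ^ (K - d) mod 2) * ((c * real d + g i) / 2 ^ d))
      = ((c * real K + g i) * real (B i) - c * real (bit_weight (B i))) / 2 ^ K" by (rule digit_mean)
  qed
  finally show ?thesis .
qed

section \<open>Cost and output of FLDR trees\<close>

lemma labels_zero_to_back: "labels (zero_to_back S) = labels S - {0}"
  by (induction S) auto

lemma fldr_depth_eq:
  assumes "(\<Sum>i=1..n. A i) \<le> 2 ^ K" "2 ^ K < 2 * (\<Sum>i=1..n. A i)"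
  shows "fldr_depth n A = K"
proof -
  define M where "M = (\<Sum>i=1..n. A i)"
  have M: "M \<le> 2 ^ K" "2 ^ K < 2 * M" using assms by (simp_all add: M_def)
  have M0: "0 < M" using M(2) by (cases M) auto
  have "real M \<le> real (2 ^ K)" "real (2 ^ K) < real (2 * M)"
    using M by (simp_all only: of_nat_le_iff of_nat_less_iff)
  then have "log 2 (real M) \<le> log 2 (2 ^ K)" "log 2 (2 ^ K) < log 2 (2 * real M)"
    using M0 by (simp_all del: log_pow_cancel)
  then have "log 2 (real M) \<le> real K" "real K < 1 + log 2 (real M)"
    using M0 by (simp_all add: log2_power log_mult)
  then have "\<lceil>log 2 (real M)\<rceil> = int K" by (intro ceiling_unique) auto
  then show ?thesis unfolding fldr_depth_def M_def[symmetric] by simp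
qed

lemma fldr_cost_and_output:
  fixes A :: "nat \<Rightarrow> nat"
  assumes fldr: "is_FLDR n A T" and M: "M = (\<Sum>i=1..n. A i)"
    and le: "M \<le> 2 ^ K" and gt: "2 ^ K < 2 * M"
  shows "ddg_expected_cost T = ereal ((real K * 2 ^ K - real (bit_weight (2 ^ K - M))
      - (\<Sum>i=1..n. real (bit_weight (A i)))) / real M)" (is ?cost)
    and "shannon_entropy (labels T) (ddg_output_prob T)
      = shannon_entropy {1..n} (\<lambda>i. real (A i) / real M)" (is ?entropy)
proof -
  obtain S where S: "entropy_optimal_ddg n (fldr_proposal n A) S" and T: "T = zero_to_back S"
    using fldr by (auto simp: is_FLDR_def)
  define R where "R = 2 ^ K - M"
  define B where "B i = (if i = 0 then R else A i)" for i
  have M0: "0 < M" using gt by (cases M) auto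
  have depth: "fldr_depth n A = K" using le gt by (intro fldr_depth_eq) (simp_all add: M)
  have q: "fldr_proposal n A i = real (B i) / 2 ^ K" for i
    unfolding fldr_proposal_def depth M[symmetric] using le by (simp add: B_def R_def of_nat_diff)
  have BK: "B i \<le> 2 ^ K" if "i \<le> n" for i
  proof (cases "i = 0")
    case False
    then have "A i \<le> M" unfolding M using that by (intro member_le_sum) auto
    then show ?thesis using False le by (simp add: B_def)
  qed (simp add: B_def R_def)
  have bf: "back_free S" "labels S \<subseteq> {0..n}" using S by (auto simp: entropy_optimal_ddg_def)
  have split0: "(\<Sum>i\<le>n. f i) = f 0 + (\<Sum>i=1..n. f i)" for f :: "nat \<Rightarrow> real"
    by (simp add: atMost_atLeast0 sum.atLeast_Suc_atMost)
  have opt: "descent_mean c g b S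
    = (\<Sum>i\<le>n. ((c * real K + g i) * real (B i) - c * real (bit_weight (B i))) / 2 ^ K)" for c g b
    by (rule descent_mean_optimal[OF S]) (use q BK in auto)
  have mean: "descent_mean c g b T
    = ((c * real K + b) * real R - c * real (bit_weight R)) / 2 ^ K
      + (\<Sum>i=1..n. ((c * real K + g i) * real (A i) - c * real (bit_weight (A i))) / 2 ^ K)" for c g b
    unfolding T descent_mean_zero_to_back[OF bf(1), where b' = b] opt split0
    by (intro arg_cong2[where f = "(+)"] sum.cong) (auto simp: B_def)
  have RM: "real R + real M = 2 ^ K" using le by (simp add: R_def of_nat_diff)
  have sumA: "(\<Sum>i=1..n. real (A i)) = real M" by (simp add: M)
  have ret: "descent_mean 0 (\<lambda>_. 0) 1 T = real R / 2 ^ K"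
    unfolding mean by simp
  have "real R < 2 ^ K" using RM M0 by linarith
  then have ret1: "descent_mean 0 (\<lambda>_. 0) 1 T < 1"
    unfolding ret by simp
  define e where "e = (\<Sum>t. run_prob T T t)"
  define W where "W = (\<Sum>i=1..n. real (bit_weight (A i)))"
  \<comment> \<open>The renewal equation: each back edge costs \<open>e\<close> again. Its
    coefficient \<open>R / 2 ^ K\<close> on the right is below 1, so \<open>e\<close> is
    determined.\<close>
  have "e = descent_mean 1 (\<lambda>_. 0) e T"
    using mean_cost_eq[OF ret1, of T] by (simp add: e_def)
  also have "\<dots> = ((real K + e) * real R - real (bit_weight R)) / 2 ^ K
      + (real K * real M - W) / 2 ^ K"
    unfolding mean W_def sumA[symmetric] sum_distrib_left sum_subtractf[symmetric] sum_divide_distrib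
    by simp
  finally have "e = ((real K + e) * real R - real (bit_weight R) + (real K * real M - W)) / 2 ^ K"
    by (simp only: add_divide_distrib)
  then have "e * 2 ^ K = (real K + e) * real R - real (bit_weight R) + (real K * real M - W)"
    by (subst (asm) eq_divide_eq) simp
  then have "e * real M = real K * 2 ^ K - real (bit_weight R) - W"
    unfolding RM[symmetric] by (simp add: algebra_simps)
  then have "e = (real K * 2 ^ K - real (bit_weight R) - W) / real M"
    using M0 by (simp add: field_simps)
  then show ?cost
    using ddg_expected_cost_eq[OF ret1] by (simp add: e_def W_def R_def)
  have out: "ddg_output_prob T i = real (A i) / real M" if i: "i \<in> {1..n}" for i
  proof -
    define p where "p = measure fair_bits (emitting i T T)"
    have "p = descent_mean 0 (\<lambda>j. if j = i then 1 else 0) p T"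
      using emit_prob_eq[of i T T] by (simp add: p_def)
    also have "\<dots> = p * real R / 2 ^ K
        + (\<Sum>j=1..n. if j = i then real (A i) / 2 ^ K else 0)"
      unfolding mean by (intro arg_cong2[where f = "(+)"] sum.cong) auto
    also have "\<dots> = p * real R / 2 ^ K + real (A i) / 2 ^ K" using i by simp
    finally have "p = (p * real R + real (A i)) / 2 ^ K" by (simp only: add_divide_distrib)
    then have "p * 2 ^ K = p * real R + real (A i)" by (subst (asm) eq_divide_eq) simp
    then have "p * real M = real (A i)" unfolding RM[symmetric] by (simp add: algebra_simps)
    then show ?thesis
      using M0 by (simp add: ddg_output_prob_def p_def emitting_def ddg_walk_eq field_simps)
  qed
  \<comment> \<open>The entropy of the tree ranges over the labels that occur; a missing label has
    probability 0 and contributes \<open>H1 0 = 0\<close>.\<close>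
  have "A i = 0" if "i \<in> {1..n}" "i \<notin> labels T" for i
  proof -
    have "i \<notin> labels S" using that by (simp add: T labels_zero_to_back)
    have "descent_mean 0 (\<lambda>j. if j = i then 1 else 0) 0 S
      = (\<Sum>j\<le>n. if j = i then real (A i) / 2 ^ K else 0)"
      unfolding opt using that by (intro sum.cong) (auto simp: B_def)
    also have "\<dots> = real (A i) / 2 ^ K" using that by simp
    finally have *: "descent_mean 0 (\<lambda>j. if j = i then 1 else 0) 0 S = real (A i) / 2 ^ K" .
    have "descent_mean 0 (\<lambda>j. if j = i then 1 else 0) 0 s = 0" if "i \<notin> labels s" for s :: "nat ddg"
      using that by (induction s) auto
    with * \<open>i \<notin> labels S\<close> show ?thesis by simp
  qed
  then have zero: "H1 (ddg_output_prob T i) = 0" if "i \<in> {1..n} - labels T" for i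
    using that out[of i] by (simp add: H1_def)
  have "labels T \<subseteq> {1..n}" using bf(2) by (auto simp: T labels_zero_to_back)
  then have "shannon_entropy {1..n} (ddg_output_prob T) = shannon_entropy (labels T) (ddg_output_prob T)"
    unfolding shannon_entropy_def using zero by (intro sum.mono_neutral_right) auto
  then show ?entropy
    using out by (simp add: shannon_entropy_def)
qed

theorem theorem4p7:
  fixes n m k K :: nat and a :: "nat \<Rightarrow> nat" and P :: "nat \<Rightarrow> real" and T :: "nat ddg"
  assumes "\<And>i. i \<in> {1..n} \<Longrightarrow> 0 < a i"
    and "Gcd (a ` {1..n}) = 1"
    and "m = (\<Sum>i=1..n. a i)"
    and "\<And>i. i \<in> {1..n} \<Longrightarrow> P i = real (a i) / real m"
    and "k = nat \<lceil>log 2 (real m)\<rceil>"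
    and "2 * k \<le> K"
    and "is_ALDR n a K T"
  shows "ddg_toll T < 2 \<and>
         ereal (shannon_entropy {1..n} P) \<le> ddg_expected_cost T \<and>
         ddg_expected_cost T < ereal (shannon_entropy {1..n} P + 2)"
proof -
  note pos = assms(1) and gcd = assms(2) and m = assms(3) and P = assms(4) and k = assms(5)
    and K = assms(6)
  have ne: "{1..n} \<noteq> {}" using gcd by (intro notI) simp
  have m0: "0 < m" unfolding m using pos ne by (intro sum_pos) auto
  define c where "c = 2 ^ K div m"
  define R where "R = 2 ^ K mod m"
  define A where "A i = c * a i" for i
  define M where "M = c * m"
  have M: "M = (\<Sum>i=1..n. A i)" by (simp add: M_def A_def m sum_distrib_left)
  have split: "2 ^ K = M + R" by (simp add: M_def R_def c_def)
  have mk: "m \<le> 2 ^ k" using ceiling_log2_bracket(1)[OF m0 k] .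
  \<comment> \<open>This makes \<open>c * m\<close> exceed half of \<open>2 ^ K\<close>, so the FLDR
    tree has depth parameter exactly \<open>K\<close>.\<close>
  have "2 * R < 2 ^ K"
  proof (cases "k = 0")
    case True
    then have "m = 1" using mk m0 by simp
    then show ?thesis by (simp add: R_def)
  next
    case False
    have "2 * R < 2 * 2 ^ k" using mk m0 mod_less_divisor[OF m0, of "2 ^ K"] by (simp add: R_def)
    also have "\<dots> = 2 ^ Suc k" by simp
    also have "\<dots> \<le> 2 ^ K" using False K by (intro power_increasing) auto
    finally show ?thesis .
  qed
  then have M_gt: "2 ^ K < 2 * M" and RK: "R < 2 ^ K" using split by linarith+
  then have M0: "0 < M" by simp
  then have c0: "0 < c" by (simp add: M_def)
  have A0: "0 < A i" if "i \<in> {1..n}" for i using pos[OF that] c0 by (simp add: A_def)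
  have fldr: "is_FLDR n A T"
    using assms(7) by (simp add: is_ALDR_def A_def[abs_def] c_def m)
  define e where "e = (real K * 2 ^ K - real (bit_weight R) - (\<Sum>i=1..n. real (bit_weight (A i)))) / real M"
  have "2 ^ K - M = R" using split by simp
  then have cost: "ddg_expected_cost T = ereal e"
    using fldr_cost_and_output(1)[OF fldr M _ M_gt] split by (simp add: e_def)
  have "shannon_entropy (labels T) (ddg_output_prob T) = shannon_entropy {1..n} (\<lambda>i. real (A i) / real M)"
    using fldr_cost_and_output(2)[OF fldr M _ M_gt] split by simp
  moreover have PA: "P i = real (A i) / real M" if "i \<in> {1..n}" for i
    using c0 P[OF that] by (simp add: A_def M_def)
  ultimately have ent: "shannon_entropy (labels T) (ddg_output_prob T) = shannon_entropy {1..n} P"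
    by (simp add: shannon_entropy_def)
  define H where "H = shannon_entropy {1..n} P"
  define L where "L = (\<Sum>i=1..n. real (A i) * log 2 (real (A i)))"
  have sumA: "(\<Sum>i=1..n. real (A i)) = real M" by (simp add: M)
  have "real M * H = (\<Sum>i=1..n. real (A i) * log 2 (real M) - real (A i) * log 2 (real (A i)))"
    unfolding H_def shannon_entropy_def sum_distrib_left
  proof (rule sum.cong[OF refl])
    fix i assume i: "i \<in> {1..n}"
    show "real M * H1 (P i) = real (A i) * log 2 (real M) - real (A i) * log 2 (real (A i))"
      using A0[OF i] M0 by (simp add: PA[OF i] H1_eq log_divide algebra_simps)
  qed
  then have MH: "real M * H = real M * log 2 (real M) - L"
    unfolding sum_subtractf sum_distrib_right[symmetric] sumA L_def .
  have Me: "real M * e = real K * 2 ^ K - real (bit_weight R) - (\<Sum>i=1..n. real (bit_weight (A i)))"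
    using M0 by (simp add: e_def)
  have "real (2 ^ K) = real (M + R)" by (simp only: split)
  then have KR: "2 ^ K - real R = real M" by simp
  \<comment> \<open>Both bounds follow from this identity: its two summands are nonnegative, and
    \<open>L\<close> minus the weights is \<open>2 * M\<close> minus the total slack.\<close>
  have toll: "real M * (e - H) = excess K R + (L - (\<Sum>i=1..n. real (bit_weight (A i))))"
    unfolding right_diff_distrib MH Me excess_def KR by simp
  have "(\<Sum>i=1..n. real (bit_weight (A i))) \<le> L"
    unfolding L_def by (intro sum_mono bit_weight_le)
  then have "0 \<le> real M * (e - H)" using toll excess_nonneg[OF RK] by simp
  then have lower: "H \<le> e" using M0 by (simp add: zero_le_mult_iff)
  have "(\<Sum>i=1..n. slack (A i)) = 2 * real M - L + (\<Sum>i=1..n. real (bit_weight (A i)))"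
    unfolding slack_def sum.distrib sum_subtractf sum_distrib_left[symmetric] sumA L_def ..
  moreover have "excess K R < (\<Sum>i=1..n. slack (A i))"
    using slack_sum_gt[OF pos gcd m k K] by (simp add: R_def A_def c_def)
  ultimately have "real M * (e - H) < real M * 2" using toll by simp
  then have "e - H < 2" using M0 by simp
  with lower show ?thesis
    by (simp add: ddg_toll_def cost ent H_def)
qed

end
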